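(* Let $R$ be either an integral domain in which $2$ is a unit or a field of characteristic $2$. If $K=E^2L$ is a simplicial double suspension (of a reduced simplicial set $L$), then the graded algebra underlying $\mathfrak L_2(K)$ is (isomorphic to) $T\big(\mathfrak A^{\mathbb N}(C_+EL)(C_+L)\big)$.
   Context: Chain (co)algebras are over $R$, with $R$-free underlying graded modules; the Koszul sign convention is used. $V_+=V_{>0}$; $s^{-1}$ is desuspension; $s^{-1}1:=0$. $E$ is the simplicial (Kan) suspension functor on reduced simplicial sets; $C(K)$ is the normalized chain coalgebra of $K$ with coefficients in $R$, and $C_+K=C(K)_{>0}$ (so $s^{-1}C_+EX\cong C_+X$). For a connected chain coalgebra $C$, $\Omega C=(T(s^{-1}C_+),d_\Omega)$, $d_\Omega(s^{-1}c)=-s^{-1}(dc)+\sum(-1)^{|c_i|}s^{-1}c_i\,s^{-1}c^i$, where $\overline\Delta(c)=\sum c_i\otimes c^i$ is the reduced comultiplication. Milgram's map $q:\Omega(C\otimes C)\to\Omega C\otimes\Omega C$ is the chain algebra map with $q(s^{-1}(c\otimes1))=s^{-1}c\otimes1$, $q(s^{-1}(1\otimes d))=1\otimes s^{-1}d$, $q(s^{-1}(c\otimes d))=0$ for $c,d\in C_+$. The Alexander-Whitney coalgebra $\widetilde C(K)$ (Hess–Parent–Scott–Tonks). For $K$ $1$-reduced, $\widetilde C(K)=(C(K),\Psi_K)$, where $\Psi_K:\Omega C(K)\to\Omega(C(K)\otimes C(K))$ is the composite of $\Omega C(\mathrm{diag}):\Omega C(K)\to\Omega C(K\times K)$ with the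 chain algebra map $\Omega C(K\times K)\to\Omega(C(K)\otimes C(K))$, $s^{-1}x\mapsto\sum_{k\ge1}t_k(x)$, where $t_1=s^{-1}f_{AW}$, $t_k=-\sum_{i+j=k}\mathrm{mult}\circ(t_i\otimes t_j)\overline\Delta\varphi$ for $k\ge2$; here $f_{AW}$ is the Alexander-Whitney map, $\nabla$ the shuffle map and $\varphi$ the natural Eilenberg–Mac Lane homotopy, $d\varphi+\varphi d=\nabla f_{AW}-1$, $\varphi\nabla=0$, $f_{AW}\varphi=0$, $\varphi^2=0$. It is known that $\psi=q\Psi_K$ is coassociative, so $\widetilde\Omega\widetilde C(K)=(\Omega C(K),\psi)$ is a chain Hopf algebra; it is known (Hess–Parent–Scott) that it is primitively generated when $K$ is a double suspension. The model $\mathfrak L_2(K)$. Let $K$ be $2$-reduced, $C=C(K)$. $\mathfrak P(C)=R\oplus C_+\oplus\overline C_+$, $\overline C_+=s^{-1}C_+$, $\bar c=s^{-1}c$, with $\tilde dc=dc-\bar c$, $\tilde d\bar c=-\overline{dc}$, comultiplication extending $\Delta$ and $\widetilde\Delta(\bar c)=(\sigma\otimes\iota+\iota\otimes\sigma)\Delta(c)$, where $\iota(c)=c$, $\sigma(c)=\bar c$, $\sigma(1)=0$; $\pi:\mathfrak P(C)\to C$ is the projection killing $\overline C_+$. Let $\iota:\Omega C\to\Omega\mathfrak P(C)$ be the (nondifferential) inclusion of algebras and $\kappa:\Omega C\to\Omega\mathfrak P(C)$ the degree $-1$ $(\iota,\iota)$-derivation with $\kappa(s^{-1}c)=-s^{-1}\bar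 c$. $\Omega\mathfrak P(C)$ is a chain Hopf algebra with comultiplication the algebra map $\tilde\psi$ with $\tilde\psi(s^{-1}c)=(\iota\otimes\iota)\psi(s^{-1}c)$, $\tilde\psi(s^{-1}\bar c)=-(\kappa\otimes\iota+\iota\otimes\kappa)\psi(s^{-1}c)$. Then $\mathfrak L_2(K)=\mathfrak L_2(\widetilde C(K))=\{x\in\Omega\mathfrak P(C):(1\otimes\Omega\pi)\tilde\psi(x)=x\otimes1\}$, a sub chain algebra. For graded modules $V$, $W$, $\mathfrak A^{\mathbb N}(V)(W)$ denotes the graded submodule of the free graded Lie algebra $\mathbb L(V\oplus W)$ (inside $T(V\oplus W)$) spanned by all iterated graded commutators $[v_1,[v_2,[\dots[v_k,w]\dots]]]$ with $k\ge0$, $v_i\in V$, $w\in W$. *)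

theory Defs
  imports Complex_Main "HOL-Library.Poly_Mapping" "HOL-Algebra.QuotRing" "HOL-Algebra.Module"
begin

section \<open>Free modules and tensor algebras on a basis\<close>

text \<open>
  A free module is represented by finitely supported functions \<open>'b \<Rightarrow>\<^sub>0 'r\<close> on a type containing
  its basis. The tensor algebra on it has the words in the basis as its basis; with concatenation
  as the monoid structure on words, the convolution product of \<open>Poly_Mapping\<close> is the
  multiplication of the tensor algebra.
\<close>

instantiation list :: (type) monoid_add
begin
definition zero_list :: "'a list" where "zero_list = []"
definition plus_list :: "'a list \<Rightarrow> 'a list \<Rightarrow> 'a list" where "plus_list xs ys = xs @ ys"
instance by standard (simp_all add: zero_list_def plus_list_def)
end

definition scal :: "'r::comm_ring_1 \<Rightarrow> ('b \<Rightarrow>\<^sub>0 'r) \<Rightarrow> ('b \<Rightarrow>\<^sub>0 'r)" where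
  "scal r p = Poly_Mapping.map ((*) r) p"

lemma lookup_scal: "Poly_Mapping.lookup (scal r p) b = r * Poly_Mapping.lookup p b"
  by (simp add: scal_def Poly_Mapping.map.rep_eq when_def)

lemma module_scal: "Modules.module (scal :: 'r::comm_ring_1 \<Rightarrow> ('b \<Rightarrow>\<^sub>0 'r) \<Rightarrow> _)"
  by unfold_locales (auto intro!: poly_mapping_eqI simp: lookup_scal lookup_add algebra_simps)

text \<open>Linear extension of a map given on the basis.\<close>

definition lin :: "('b \<Rightarrow> ('c \<Rightarrow>\<^sub>0 'r)) \<Rightarrow> ('b \<Rightarrow>\<^sub>0 'r::comm_ring_1) \<Rightarrow> ('c \<Rightarrow>\<^sub>0 'r)" where
  "lin f p = (\<Sum>b\<in>Poly_Mapping.keys p. scal (Poly_Mapping.lookup p b) (f b))"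

abbreviation gen :: "'b \<Rightarrow> ('b \<Rightarrow>\<^sub>0 'r::comm_ring_1)" where
  "gen b \<equiv> Poly_Mapping.single b 1"

definition koszul :: "nat \<Rightarrow> ('b \<Rightarrow>\<^sub>0 'r::comm_ring_1) \<Rightarrow> ('b \<Rightarrow>\<^sub>0 'r)" where
  "koszul n p = scal ((-1) ^ n) p"

definition tens :: "('b \<Rightarrow>\<^sub>0 'r::comm_ring_1) \<Rightarrow> ('c \<Rightarrow>\<^sub>0 'r) \<Rightarrow> ('b \<times> 'c \<Rightarrow>\<^sub>0 'r)" where
  "tens x y = lin (\<lambda>b. lin (\<lambda>c. gen (b, c)) y) x"

text \<open>Tensor product of two linear maps; no sign arises if the second one has degree \<open>0\<close>.\<close>

definition tens_map ::
  "(('b \<Rightarrow>\<^sub>0 'r::comm_ring_1) \<Rightarrow> ('d \<Rightarrow>\<^sub>0 'r)) \<Rightarrow> (('c \<Rightarrow>\<^sub>0 'r) \<Rightarrow> ('e \<Rightarrow>\<^sub>0 'r)) \<Rightarrow>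
   ('b \<times> 'c \<Rightarrow>\<^sub>0 'r) \<Rightarrow> ('d \<times> 'e \<Rightarrow>\<^sub>0 'r)" where
  "tens_map f g = lin (\<lambda>(b, c). tens (f (gen b)) (g (gen c)))"

definition wdeg :: "('b \<Rightarrow> nat) \<Rightarrow> 'b list \<Rightarrow> nat" where
  "wdeg deg w = sum_list (map deg w)"

text \<open>
  The unique algebra map from a tensor algebra to an algebra (with multiplication \<open>mul\<close> and unit
  \<open>e\<close>) that extends a map on generators.
\<close>

definition alg_ext ::
  "(('c \<Rightarrow>\<^sub>0 'r) \<Rightarrow> ('c \<Rightarrow>\<^sub>0 'r) \<Rightarrow> ('c \<Rightarrow>\<^sub>0 'r)) \<Rightarrow> ('c \<Rightarrow>\<^sub>0 'r) \<Rightarrow>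
   ('b \<Rightarrow> ('c \<Rightarrow>\<^sub>0 'r)) \<Rightarrow> ('b list \<Rightarrow>\<^sub>0 'r::comm_ring_1) \<Rightarrow> ('c \<Rightarrow>\<^sub>0 'r)" where
  "alg_ext mul e f = lin (\<lambda>w. foldr (\<lambda>b. mul (f b)) w e)"

text \<open>
  Multiplication of the tensor product of two tensor algebras,
  \<open>(u \<otimes> v)(u' \<otimes> v') = (-1)\<^bsup>|v||u'|\<^esup> uu' \<otimes> vv'\<close>.
\<close>

definition tt_mult ::
  "('b \<Rightarrow> nat) \<Rightarrow> ('c \<Rightarrow> nat) \<Rightarrow> ('b list \<times> 'c list \<Rightarrow>\<^sub>0 'r::comm_ring_1) \<Rightarrow>
   ('b list \<times> 'c list \<Rightarrow>\<^sub>0 'r) \<Rightarrow> ('b list \<times> 'c list \<Rightarrow>\<^sub>0 'r)" where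
  "tt_mult d1 d2 x y =
     lin (\<lambda>(u, v). lin (\<lambda>(u', v'). koszul (wdeg d2 v * wdeg d1 u') (gen (u @ u', v @ v'))) y) x"

abbreviation tt_one :: "'b list \<times> 'c list \<Rightarrow>\<^sub>0 'r::comm_ring_1" where
  "tt_one \<equiv> gen ([], [])"


section \<open>Simplicial sets and the Kan suspension\<close>

text \<open>
  \<open>face X n i\<close> and \<open>degen X n i\<close> are the operators \<open>d\<^sub>i\<close> and \<open>s\<^sub>i\<close> on \<open>n\<close>-simplices. The sets of
  simplices of different dimensions need not be disjoint.
\<close>

record 'a sset =
  simp :: "nat \<Rightarrow> 'a set"
  face :: "nat \<Rightarrow> nat \<Rightarrow> 'a \<Rightarrow> 'a"
  degen :: "nat \<Rightarrow> nat \<Rightarrow> 'a \<Rightarrow> 'a"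

locale simplicial_set =
  fixes X :: "'a sset"
  assumes face_closed: "x \<in> simp X (Suc n) \<Longrightarrow> i \<le> Suc n \<Longrightarrow> face X (Suc n) i x \<in> simp X n"
    and degen_closed: "x \<in> simp X n \<Longrightarrow> i \<le> n \<Longrightarrow> degen X n i x \<in> simp X (Suc n)"
    and face_face: "x \<in> simp X (Suc (Suc n)) \<Longrightarrow> i < j \<Longrightarrow> j \<le> Suc (Suc n) \<Longrightarrow>
      face X (Suc n) i (face X (Suc (Suc n)) j x) = face X (Suc n) (j - 1) (face X (Suc (Suc n)) i x)"
    and degen_degen: "x \<in> simp X n \<Longrightarrow> i \<le> j \<Longrightarrow> j \<le> n \<Longrightarrow>
      degen X (Suc n) i (degen X n j x) = degen X (Suc n) (Suc j) (degen X n i x)"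
    and face_degen_less: "x \<in> simp X (Suc n) \<Longrightarrow> i < j \<Longrightarrow> j \<le> Suc n \<Longrightarrow>
      face X (Suc (Suc n)) i (degen X (Suc n) j x) = degen X n (j - 1) (face X (Suc n) i x)"
    and face_degen_same: "x \<in> simp X n \<Longrightarrow> j \<le> n \<Longrightarrow> i = j \<or> i = Suc j \<Longrightarrow>
      face X (Suc n) i (degen X n j x) = x"
    and face_degen_greater: "x \<in> simp X (Suc n) \<Longrightarrow> Suc j < i \<Longrightarrow> i \<le> Suc (Suc n) \<Longrightarrow>
      face X (Suc (Suc n)) i (degen X (Suc n) j x) = degen X n j (face X (Suc n) (i - 1) x)"

definition reduced :: "'a sset \<Rightarrow> bool" where
  "reduced X \<longleftrightarrow> (\<exists>v. simp X 0 = {v})"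

primrec base :: "'a sset \<Rightarrow> nat \<Rightarrow> 'a" where
  "base X 0 = the_elem (simp X 0)"
| "base X (Suc n) = degen X n 0 (base X n)"

definition nondegenerate :: "'a sset \<Rightarrow> nat \<Rightarrow> 'a \<Rightarrow> bool" where
  "nondegenerate X n x \<longleftrightarrow> x \<in> simp X n \<and> (\<forall>m i y. n = Suc m \<and> i \<le> m \<and> y \<in> simp X m \<longrightarrow> x \<noteq> degen X m i y)"

definition sprod :: "'a sset \<Rightarrow> 'b sset \<Rightarrow> ('a \<times> 'b) sset" where
  "sprod X Y = \<lparr>simp = (\<lambda>n. simp X n \<times> simp Y n),
     face = (\<lambda>n i (x, y). (face X n i x, face Y n i y)),
     degen = (\<lambda>n i (x, y). (degen X n i x, degen Y n i y))\<rparr>"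

text \<open>
  The Kan suspension of a reduced simplicial set. In dimension \<open>n\<close> it consists of the symbols
  \<open>(i, x)\<close> with \<open>1 \<le> i \<le> n\<close> and \<open>x \<in> X\<^bsub>n-i\<^esub>\<close>, where \<open>(i, x)\<close> is identified with the base point
  if \<open>x\<close> is the base point; the base point in each dimension is \<open>None\<close>. The operators are determined
  by \<open>d\<^sub>0 (1, x) = *\<close>, \<open>d\<^bsub>j+1\<^esub> (1, x) = (1, d\<^sub>j x)\<close> (and \<open>d\<^sub>1 (1, x) = *\<close> for \<open>x\<close> of dimension \<open>0\<close>),
  \<open>s\<^sub>0 (i, x) = (i + 1, x)\<close>, \<open>s\<^bsub>j+1\<^esub> (1, x) = (1, s\<^sub>j x)\<close> and the simplicial identities, since
  \<open>(i, x) = s\<^sub>0\<^bsup>i-1\<^esup> (1, x)\<close>.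
\<close>

definition susp_simplex :: "'a sset \<Rightarrow> nat \<Rightarrow> nat \<Rightarrow> 'a \<Rightarrow> (nat \<times> 'a) option" where
  "susp_simplex X m i x = (if x = base X m then None else Some (i, x))"

definition susp :: "'a sset \<Rightarrow> (nat \<times> 'a) option sset" where
  "susp X = \<lparr>
     simp = (\<lambda>n. insert None {susp_simplex X (n - i) i x | i x. 1 \<le> i \<and> i \<le> n \<and> x \<in> simp X (n - i)}),
     face = (\<lambda>n j z. case z of None \<Rightarrow> None
       | Some (i, x) \<Rightarrow>
           if j < i then (if i = 1 then None else Some (i - 1, x))
           else if n = i then None
           else susp_simplex X (n - i - 1) i (face X (n - i) (j - i) x)),
     degen = (\<lambda>n j z. case z of None \<Rightarrow> None
       | Some (i, x) \<Rightarrow>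
           if j < i then Some (i + 1, x)
           else susp_simplex X (n - i + 1) i (degen X (n - i) (j - i) x))\<rparr>"


section \<open>Normalized chains and the Eilenberg--Zilber data\<close>

text \<open>
  The basis of the normalized chains \<open>C(X)\<close> consists of the pairs \<open>(n, x)\<close> with \<open>x\<close> a nondegenerate
  \<open>n\<close>-simplex. If \<open>X\<close> is reduced, the only basis element of degree \<open>0\<close> is \<open>1\<close>.
\<close>

type_synonym 'a simplex = "nat \<times> 'a"

definition pos_basis :: "'a sset \<Rightarrow> 'a simplex set" where
  "pos_basis X = {(n, x). n > 0 \<and> nondegenerate X n x}"

definition nchain :: "'a sset \<Rightarrow> nat \<Rightarrow> 'a \<Rightarrow> ('a simplex \<Rightarrow>\<^sub>0 'r::comm_ring_1)" where
  "nchain X n x = (if nondegenerate X n x then gen (n, x) else 0)"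

text \<open>\<open>d\<^bsub>m-j+1\<^esub> \<dots> d\<^sub>m x\<close>, for \<open>x\<close> of dimension \<open>m\<close>\<close>

primrec last_faces :: "'a sset \<Rightarrow> nat \<Rightarrow> nat \<Rightarrow> 'a \<Rightarrow> 'a" where
  "last_faces X m 0 x = x"
| "last_faces X m (Suc j) x = last_faces X (m - 1) j (face X m m x)"

text \<open>\<open>d\<^sub>k\<^bsup>p\<^esup> x\<close>, for \<open>x\<close> of dimension \<open>m\<close>\<close>

primrec rep_face :: "'a sset \<Rightarrow> nat \<Rightarrow> nat \<Rightarrow> nat \<Rightarrow> 'a \<Rightarrow> 'a" where
  "rep_face X k m 0 x = x"
| "rep_face X k m (Suc p) x = rep_face X k (m - 1) p (face X m k x)"

text \<open>\<open>s\<^bsub>i\<^sub>r\<^esub> \<dots> s\<^bsub>i\<^sub>1\<^esub> x\<close>, for \<open>x\<close> of dimension \<open>m\<close> and \<open>[i\<^sub>1, \<dots>, i\<^sub>r]\<close> the given list\<close>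

primrec degens :: "'a sset \<Rightarrow> nat \<Rightarrow> nat list \<Rightarrow> 'a \<Rightarrow> 'a" where
  "degens X m [] x = x"
| "degens X m (i # is) x = degens X (Suc m) is (degen X m i x)"

fun aw :: "'a sset \<Rightarrow> 'b sset \<Rightarrow> ('a \<times> 'b) simplex \<Rightarrow> ('a simplex \<times> 'b simplex \<Rightarrow>\<^sub>0 'r::comm_ring_1)" where
  "aw X Y (n, (x, y)) = (\<Sum>p\<le>n. tens (nchain X p (last_faces X n (n - p) x))
                                      (nchain Y (n - p) (rep_face Y 0 n p y)))"

fun reduced_comult :: "'a sset \<Rightarrow> 'a simplex \<Rightarrow> ('a simplex \<times> 'a simplex \<Rightarrow>\<^sub>0 'r::comm_ring_1)" where
  "reduced_comult X (n, x) = (\<Sum>p\<in>{0<..<n}. tens (nchain X p (last_faces X n (n - p) x))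
                                                 (nchain X (n - p) (rep_face X 0 n p x)))"

text \<open>
  For an operator \<open>F\<close> on \<open>n\<close>-simplices built from \<open>d\<^sub>i\<close>'s and \<open>s\<^sub>i\<close>'s, its derived operator \<open>F'\<close>
  on \<open>(n + 1)\<close>-simplices is obtained by raising all indices by one. The function below is
  the \<open>k\<close>-th derived operator of \<open>\<nabla> f\<^bsub>AW\<^esub>\<close> on \<open>n\<close>-simplices; for \<open>k = 0\<close> it is
  \<open>\<nabla> f\<^bsub>AW\<^esub> (x, y) = \<Sum> sgn(\<mu>,\<nu>) (s\<^bsub>\<nu>\<^sub>q\<^esub> \<dots> s\<^bsub>\<nu>\<^sub>1\<^esub> d\<^bsub>p+1\<^esub> \<dots> d\<^sub>n x, s\<^bsub>\<mu>\<^sub>p\<^esub> \<dots> s\<^bsub>\<mu>\<^sub>1\<^esub> d\<^sub>0\<^bsup>p\<^esup> y)\<close>, summed over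
  all \<open>p + q = n\<close> and all \<open>(p, q)\<close>-shuffles \<open>(\<mu>, \<nu>)\<close>,
  where \<open>A\<close> below is the set of the \<open>\<mu>\<^sub>i\<close>, so that the complement of \<open>A\<close> is the set of the \<open>\<nu>\<^sub>i\<close>.
\<close>

fun shuffle_aw :: "'a sset \<Rightarrow> 'b sset \<Rightarrow> nat \<Rightarrow> nat \<Rightarrow> 'a \<times> 'b \<Rightarrow> (('a \<times> 'b) simplex \<Rightarrow>\<^sub>0 'r::comm_ring_1)" where
  "shuffle_aw X Y k n (x, y) =
     (\<Sum>p\<le>n. \<Sum>A\<in>{A. A \<subseteq> {..<n} \<and> card A = p}.
        koszul (card {(b, a). a \<in> A \<and> b \<in> {..<n} - A \<and> b < a})
          (nchain (sprod X Y) (n + k)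
             (degens X (p + k) (map (\<lambda>i. i + k) (sorted_list_of_set ({..<n} - A)))
                (last_faces X (n + k) (n - p) x),
              degens Y (n - p + k) (map (\<lambda>i. i + k) (sorted_list_of_set A))
                (rep_face Y k (n + k) p y))))"

text \<open>
  The \<open>k\<close>-th derived operator of the Eilenberg--Mac Lane homotopy on \<open>n\<close>-simplices, defined by
  the recursion \<open>\<phi>\<^sub>0 = 0\<close>, \<open>\<phi>\<^sub>n = -(\<phi>\<^bsub>n-1\<^esub>)' + (\<nabla> f\<^bsub>AW\<^esub>)' s\<^sub>0\<close> of Eilenberg and Mac Lane. This is the
  homotopy with \<open>d \<phi> + \<phi> d = \<nabla> f\<^bsub>AW\<^esub> - 1\<close>.
\<close>

primrec em_derived :: "'a sset \<Rightarrow> 'b sset \<Rightarrow> nat \<Rightarrow> nat \<Rightarrow> 'a \<times> 'b \<Rightarrow> (('a \<times> 'b) simplex \<Rightarrow>\<^sub>0 'r::comm_ring_1)" where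
  "em_derived X Y k 0 z = 0"
| "em_derived X Y k (Suc n) z =
     - em_derived X Y (Suc k) n z
     + shuffle_aw X Y (Suc k) (Suc n) (degen (sprod X Y) (Suc n + k) k z)"

fun em_homotopy :: "'a sset \<Rightarrow> 'b sset \<Rightarrow> ('a \<times> 'b) simplex \<Rightarrow> (('a \<times> 'b) simplex \<Rightarrow>\<^sub>0 'r::comm_ring_1)" where
  "em_homotopy X Y (n, z) = em_derived X Y 0 n z"


section \<open>The Alexander--Whitney coalgebra and the diagonal on the cobar construction\<close>

text \<open>
  The graded algebra underlying \<open>\<Omega> C(X)\<close> has the words in \<open>pos_basis X\<close> as its basis, the
  letter \<open>c\<close> standing for \<open>s\<^sup>-\<^sup>1 c\<close>. The letters of \<open>\<Omega>(C(X) \<otimes> C(X))\<close> are pairs of basis elements of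
  \<open>C(X)\<close>, not both of degree \<open>0\<close>. Differentials are not needed, since none of the algebra and
  linear maps below refers to them and only the graded algebra underlying the final model
  is considered.
\<close>

definition cobar_deg :: "'a simplex \<Rightarrow> nat" where
  "cobar_deg c = fst c - 1"

definition cobar_diag :: "('a simplex list \<Rightarrow>\<^sub>0 'r::comm_ring_1) \<Rightarrow> (('a \<times> 'a) simplex list \<Rightarrow>\<^sub>0 'r)" where
  "cobar_diag = alg_ext (*) 1 (\<lambda>(n, x). gen [(n, (x, x))])"

text \<open>
  The maps \<open>t\<^sub>k : C\<^sub>+(X \<times> X) \<rightarrow> \<Omega>(C(X) \<otimes> C(X))\<close> of degree \<open>-1\<close>; the sign comes from
  \<open>(t\<^sub>i \<otimes> t\<^sub>j)(a \<otimes> b) = (-1)\<^bsup>|a|\<^esup> t\<^sub>i a \<otimes> t\<^sub>j b\<close>.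
\<close>

function aw_t :: "'a sset \<Rightarrow> nat \<Rightarrow> ('a \<times> 'a) simplex \<Rightarrow>
    (('a simplex \<times> 'a simplex) list \<Rightarrow>\<^sub>0 'r::comm_ring_1)" where
  "aw_t X 0 c = 0"
| "aw_t X (Suc 0) c = lin (\<lambda>b. gen [b]) (aw X X c)"
| "aw_t X (Suc (Suc k)) c =
     - (\<Sum>i\<in>{1..Suc k}. lin (\<lambda>(a, b). koszul (fst a) (aw_t X i a * aw_t X (Suc (Suc k) - i) b))
          (lin (reduced_comult (sprod X X)) (em_homotopy X X c)))"
  by pat_completeness auto
termination by (relation "measure (\<lambda>(X, k, c). k)") auto

text \<open>For \<open>1\<close>-reduced \<open>X\<close> and \<open>c\<close> of degree \<open>n > 0\<close>, \<open>t\<^sub>k c = 0\<close> if \<open>k \<ge> n\<close>, hence the sum is finite.\<close>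

definition cobar_twist :: "'a sset \<Rightarrow> (('a \<times> 'a) simplex list \<Rightarrow>\<^sub>0 'r::comm_ring_1) \<Rightarrow>
    (('a simplex \<times> 'a simplex) list \<Rightarrow>\<^sub>0 'r)" where
  "cobar_twist X = alg_ext (*) 1 (\<lambda>c. Sum_any (\<lambda>k. aw_t X (Suc k) c))"

definition aw_Psi :: "'a sset \<Rightarrow> ('a simplex list \<Rightarrow>\<^sub>0 'r::comm_ring_1) \<Rightarrow>
    (('a simplex \<times> 'a simplex) list \<Rightarrow>\<^sub>0 'r)" where
  "aw_Psi X = cobar_twist X \<circ> cobar_diag"

text \<open>For reduced \<open>X\<close>, the letters \<open>c \<otimes> 1\<close> and \<open>1 \<otimes> d\<close> are the pairs with an entry of degree \<open>0\<close>.\<close>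

definition milgram :: "(('a simplex \<times> 'a simplex) list \<Rightarrow>\<^sub>0 'r::comm_ring_1) \<Rightarrow>
    ('a simplex list \<times> 'a simplex list \<Rightarrow>\<^sub>0 'r)" where
  "milgram = alg_ext (tt_mult cobar_deg cobar_deg) tt_one
     (\<lambda>(c, d). if fst d = 0 then gen ([c], []) else if fst c = 0 then gen ([], [d]) else 0)"

definition aw_psi :: "'a sset \<Rightarrow> ('a simplex list \<Rightarrow>\<^sub>0 'r::comm_ring_1) \<Rightarrow>
    ('a simplex list \<times> 'a simplex list \<Rightarrow>\<^sub>0 'r)" where
  "aw_psi X = milgram \<circ> aw_Psi X"


section \<open>Graded algebras\<close>

record ('r, 'm) graded_algebra = "('r, 'm) module" +
  component :: "nat \<Rightarrow> 'm set"

definition graded_algebra_iso ::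
  "('r, 'm) graded_algebra \<Rightarrow> ('r, 'n) graded_algebra \<Rightarrow> bool" where
  "graded_algebra_iso A B \<longleftrightarrow> (\<exists>f \<in> ring_iso A B.
     (\<forall>r. \<forall>x\<in>carrier A. f (r \<odot>\<^bsub>A\<^esub> x) = r \<odot>\<^bsub>B\<^esub> f x) \<and>
     (\<forall>n. f ` component A n = component B n))"

definition homogeneous :: "('b \<Rightarrow> nat) \<Rightarrow> nat \<Rightarrow> ('b list \<Rightarrow>\<^sub>0 'r::comm_ring_1) set" where
  "homogeneous deg n = {x. \<forall>w\<in>Poly_Mapping.keys x. wdeg deg w = n}"

text \<open>
  The tensor algebra on a graded submodule \<open>M\<close> of a tensor algebra whose letters are graded by
  \<open>deg\<close>: the free algebra on the set \<open>M\<close> modulo the two-sided ideal which makes the inclusion of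
  generators linear.
\<close>

definition free_algebra :: "'m set \<Rightarrow> ('m list \<Rightarrow>\<^sub>0 'r::comm_ring_1) ring" where
  "free_algebra M = \<lparr>carrier = {p. Poly_Mapping.keys p \<subseteq> lists M}, mult = (*), one = 1, zero = 0, add = (+)\<rparr>"

definition tensor_ideal ::
  "('b \<Rightarrow>\<^sub>0 'r::comm_ring_1) set \<Rightarrow> (('b \<Rightarrow>\<^sub>0 'r) list \<Rightarrow>\<^sub>0 'r) set" where
  "tensor_ideal M = genideal (free_algebra M)
     ({gen [a + b] - gen [a] - gen [b] | a b. a \<in> M \<and> b \<in> M} \<union>
      {gen [scal r a] - scal r (gen [a]) | r a. a \<in> M})"

definition tensor_algebra ::
  "('b \<Rightarrow> nat) \<Rightarrow> ('b list \<Rightarrow>\<^sub>0 'r::comm_ring_1) set \<Rightarrow>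
   ('r, (('b list \<Rightarrow>\<^sub>0 'r) list \<Rightarrow>\<^sub>0 'r) set) graded_algebra" where
  "tensor_algebra deg M =
    (let F = free_algebra M; I = tensor_ideal M; Q = F Quot I in
     \<lparr>carrier = carrier Q, mult = mult Q, one = one Q, zero = zero Q, add = add Q,
      smult = (\<lambda>r X. \<Union>x\<in>X. I +>\<^bsub>F\<^esub> scal r x),
      component = (\<lambda>n. {I +>\<^bsub>F\<^esub> x | x. x \<in> module.span scal
        {gen w | w. \<exists>ns. list_all2 (\<lambda>m i. m \<in> M \<inter> homogeneous deg i) w ns \<and> sum_list ns = n}})\<rparr>)"


section \<open>The model \<open>\<LL>\<^sub>2\<close>\<close>

text \<open>
  The letters of \<open>\<Omega> \<PP>(C)\<close>: \<open>Orig c\<close> stands for \<open>s\<^sup>-\<^sup>1 c\<close> and \<open>Bar c\<close> for the double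
  desuspension \<open>s\<^sup>-\<^sup>1 (s\<^sup>-\<^sup>1 c)\<close>.
\<close>

datatype 'c path_gen = Orig 'c | Bar 'c

fun path_deg :: "'a simplex path_gen \<Rightarrow> nat" where
  "path_deg (Orig c) = fst c - 1"
| "path_deg (Bar c) = fst c - 2"

definition path_carrier :: "'a sset \<Rightarrow> ('a simplex path_gen list \<Rightarrow>\<^sub>0 'r::comm_ring_1) set" where
  "path_carrier X = {x. Poly_Mapping.keys x \<subseteq> lists (Orig ` pos_basis X \<union> Bar ` pos_basis X)}"

definition path_incl :: "('a simplex list \<Rightarrow>\<^sub>0 'r::comm_ring_1) \<Rightarrow> ('a simplex path_gen list \<Rightarrow>\<^sub>0 'r)" where
  "path_incl = alg_ext (*) 1 (\<lambda>c. gen [Orig c])"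

definition path_proj :: "('a simplex path_gen list \<Rightarrow>\<^sub>0 'r::comm_ring_1) \<Rightarrow> ('a simplex list \<Rightarrow>\<^sub>0 'r)" where
  "path_proj = alg_ext (*) 1 (\<lambda>g. case g of Orig c \<Rightarrow> gen [c] | Bar c \<Rightarrow> 0)"

text \<open>\<open>\<kappa>(s\<^sup>-\<^sup>1 c w) = \<kappa>(s\<^sup>-\<^sup>1 c) \<iota>(w) + (-1)\<^bsup>|s\<^sup>-\<^sup>1 c|\<^esup> \<iota>(s\<^sup>-\<^sup>1 c) \<kappa>(w)\<close>\<close>

primrec kappa_word :: "'a simplex list \<Rightarrow> ('a simplex path_gen list \<Rightarrow>\<^sub>0 'r::comm_ring_1)" where
  "kappa_word [] = 0"
| "kappa_word (c # w) = - gen [Bar c] * path_incl (gen w) + koszul (cobar_deg c) (gen [Orig c] * kappa_word w)"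

definition kappa :: "('a simplex list \<Rightarrow>\<^sub>0 'r::comm_ring_1) \<Rightarrow> ('a simplex path_gen list \<Rightarrow>\<^sub>0 'r)" where
  "kappa = lin kappa_word"

text \<open>\<open>(\<iota> \<otimes> \<kappa>)(u \<otimes> v) = (-1)\<^bsup>|u|\<^esup> \<iota> u \<otimes> \<kappa> v\<close>, as \<open>\<kappa>\<close> has degree \<open>-1\<close>\<close>

definition incl_kappa :: "('a simplex list \<times> 'a simplex list \<Rightarrow>\<^sub>0 'r::comm_ring_1) \<Rightarrow>
    ('a simplex path_gen list \<times> 'a simplex path_gen list \<Rightarrow>\<^sub>0 'r)" where
  "incl_kappa = lin (\<lambda>(u, v). koszul (wdeg cobar_deg u) (tens (path_incl (gen u)) (kappa (gen v))))"

definition path_psi :: "'a sset \<Rightarrow> ('a simplex path_gen list \<Rightarrow>\<^sub>0 'r::comm_ring_1) \<Rightarrow>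
    ('a simplex path_gen list \<times> 'a simplex path_gen list \<Rightarrow>\<^sub>0 'r)" where
  "path_psi X = alg_ext (tt_mult path_deg path_deg) tt_one
     (\<lambda>g. case g of
        Orig c \<Rightarrow> tens_map path_incl path_incl (aw_psi X (gen [c]))
      | Bar c \<Rightarrow> - (tens_map kappa path_incl (aw_psi X (gen [c])) + incl_kappa (aw_psi X (gen [c]))))"

definition L2_carrier :: "'a sset \<Rightarrow> ('a simplex path_gen list \<Rightarrow>\<^sub>0 'r::comm_ring_1) set" where
  "L2_carrier X = {x \<in> path_carrier X. tens_map id path_proj (path_psi X x) = tens x 1}"

definition L2 :: "'a sset \<Rightarrow> ('r::comm_ring_1, 'a simplex path_gen list \<Rightarrow>\<^sub>0 'r) graded_algebra" where
  "L2 X = \<lparr>carrier = L2_carrier X, mult = (*), one = 1, zero = 0, add = (+), smult = scal,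
     component = (\<lambda>n. L2_carrier X \<inter> homogeneous path_deg n)\<rparr>"


section \<open>Iterated commutators\<close>

text \<open>
  For graded modules \<open>V\<close> and \<open>W\<close> with bases \<open>A\<close> and \<open>B\<close>, letters \<open>Inl v\<close> and \<open>Inr w\<close> are the
  generators of \<open>T(V \<oplus> W)\<close>. The commutator is the bilinear extension of
  \<open>[u, v] = uv - (-1)\<^bsup>|u||v|\<^esup> vu\<close>.
\<close>

definition gcomm :: "('b \<Rightarrow> nat) \<Rightarrow> ('b list \<Rightarrow>\<^sub>0 'r::comm_ring_1) \<Rightarrow> ('b list \<Rightarrow>\<^sub>0 'r) \<Rightarrow> ('b list \<Rightarrow>\<^sub>0 'r)" where
  "gcomm deg x y =
     lin (\<lambda>u. lin (\<lambda>v. gen u * gen v - koszul (wdeg deg u * wdeg deg v) (gen v * gen u)) y) x"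

definition sum_deg :: "('b \<Rightarrow> nat) \<Rightarrow> ('c \<Rightarrow> nat) \<Rightarrow> 'b + 'c \<Rightarrow> nat" where
  "sum_deg d1 d2 = case_sum d1 d2"

definition linear_part :: "'b set \<Rightarrow> ('b list \<Rightarrow>\<^sub>0 'r::comm_ring_1) set" where
  "linear_part S = {x. Poly_Mapping.keys x \<subseteq> (\<lambda>b. [b]) ` S}"

definition AN :: "('b \<Rightarrow> nat) \<Rightarrow> ('c \<Rightarrow> nat) \<Rightarrow> 'b set \<Rightarrow> 'c set \<Rightarrow> (('b + 'c) list \<Rightarrow>\<^sub>0 'r::comm_ring_1) set" where
  "AN d1 d2 A B = module.span scal
     {foldr (gcomm (sum_deg d1 d2)) vs w | vs w.
        set vs \<subseteq> linear_part (Inl ` A) \<and> w \<in> linear_part (Inr ` B)}"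

end

theory Submission
  imports Defs "HOL-Library.Multiset"
begin

text \<open>
  For a nondegenerate simplex \<open>z\<close> of a double suspension, every summand of \<open>\<phi>(z, z)\<close> is degenerate
  or has two components in which the cone vertex occurs at most once. The proper back faces of the
  latter are trivial, hence the reduced diagonal of \<open>\<phi>(z, z)\<close> vanishes, \<open>t\<^sub>k(z, z) = 0\<close> for \<open>k \<ge> 2\<close>,
  and all letters of \<open>\<Omega>C\<close> and of \<open>\<Omega>\<PP>(C)\<close> are primitive. The products of iterated commutators
  \<open>[v\<^sub>1, [\<dots>, [v\<^sub>k, w]]]\<close>, followed by words in the \<open>v\<close>'s, are unitriangular with respect to the words,
  so they form a basis of \<open>\<Omega>\<PP>(C)\<close>. The commutators are coinvariant, and comparing the components
  of maximal length in the second tensor factor shows that a coinvariant element involves only basis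
  elements whose last word is empty. So \<open>\<LL>\<^sub>2\<close> is free on the iterated commutators.
\<close>

section \<open>Linear maps between free modules\<close>

text \<open>Only supports are followed through the Eilenberg--Mac Lane homotopy: the summands are
  harmless one at a time, so shuffle signs never enter. In \<open>Some (i, x)\<close> the cone
  vertex is repeated \<open>i\<close> times, and a nondegenerate \<open>z\<close> is
  \<open>(1, (1, y))\<close>. The derived part of the recursion for \<phi> raises all indices and
  hence keeps the cone vertex of \<open>z\<close>. The term needing care is
  \<open>(\<nabla> f)' s_0\<close>, which starts from the degenerate simplex
  \<open>(2, (1, y))\<close>: there \<open>d_1\<close> removes the repetition, and a further
  \<open>d_1\<close> is \<open>d_0\<close> on the inner simplex \<open>(1, y)\<close>, trivial
  because that is a cone as well. This is where the second suspension matters. It also explains the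
  two modules in the answer: coning once identifies \<open>C_+EL\<close> with the letters
  \<open>Orig\<close>, coning twice identifies \<open>C_+L\<close> with the letters
  \<open>Bar\<close>, degrees included. The basis is that of the elimination isomorphism
  \<open>T(V \<oplus> W) = T(A(V)(W)) \<otimes> T(V)\<close>. Since the tensor algebra of the goal
  is a quotient of the free algebra on a set, freeness has to be turned into the computation of a
  kernel.\<close>

interpretation scal: Modules.module "scal :: 'r::comm_ring_1 \<Rightarrow> ('b \<Rightarrow>\<^sub>0 'r) \<Rightarrow> _"
  by (rule module_scal)

lemma keys_scal: "Poly_Mapping.keys (scal r p) \<subseteq> Poly_Mapping.keys p"
  by (metis in_keys_iff lookup_scal mult_zero_right subsetI)

lemma scal_minus: "- p = scal (- 1) p"
  by (auto intro!: poly_mapping_eqI simp: lookup_scal)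

lemma scal_single: "scal r (Poly_Mapping.single b s) = Poly_Mapping.single b (r * s)"
  by (auto intro!: poly_mapping_eqI simp: lookup_scal lookup_single when_def)

lemma lin_superset:
  assumes "finite S" "Poly_Mapping.keys p \<subseteq> S"
  shows "lin f p = (\<Sum>b\<in>S. scal (Poly_Mapping.lookup p b) (f b))"
  unfolding lin_def by (rule sum.mono_neutral_left) (use assms in \<open>auto simp: in_keys_iff\<close>)

lemma lin_add [simp]: "lin f (p + q) = lin f p + lin f q"
proof -
  let ?S = "Poly_Mapping.keys p \<union> Poly_Mapping.keys q"
  have "lin f (p + q) = (\<Sum>b\<in>?S. scal (Poly_Mapping.lookup (p + q) b) (f b))"
    by (rule lin_superset) (auto simp: keys_add)
  also have "\<dots> = (\<Sum>b\<in>?S. scal (Poly_Mapping.lookup p b) (f b)) + (\<Sum>b\<in>?S. scal (Poly_Mapping.lookup q b) (f b))"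
    by (simp add: lookup_add scal.scale_left_distrib sum.distrib)
  also have "\<dots> = lin f p + lin f q"
    by (simp add: lin_superset[of ?S])
  finally show ?thesis .
qed

lemma lin_scal [simp]: "lin f (scal r p) = scal r (lin f p)"
proof -
  have "lin f (scal r p) = (\<Sum>b\<in>Poly_Mapping.keys p. scal (Poly_Mapping.lookup (scal r p) b) (f b))"
    by (rule lin_superset) (auto simp: keys_scal)
  then show ?thesis by (simp add: lin_def lookup_scal scal.scale_sum_right)
qed

lemma lin_zero [simp]: "lin f 0 = 0"
  by (simp add: lin_def)

lemma lin_uminus [simp]: "lin f (- p) = - lin f p"
  by (metis lin_scal scal_minus)

lemma lin_diff [simp]: "lin f (p - q) = lin f p - lin f q"
  by (metis lin_add lin_uminus add_uminus_conv_diff)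

lemma lin_gen [simp]: "lin f (gen b) = f b"
  by (simp add: lin_def)

lemma lin_gen_id: "lin gen p = p"
proof (rule poly_mapping_eqI)
  fix k
  have "Poly_Mapping.lookup (lin gen p) k =
      (\<Sum>b\<in>Poly_Mapping.keys p. Poly_Mapping.lookup p b * (if b = k then 1 else 0))"
    by (simp add: lin_def lookup_sum lookup_scal lookup_single when_def cong: if_cong)
  also have "\<dots> = Poly_Mapping.lookup p k"
    by (simp add: in_keys_iff if_distrib cong: if_cong)
  finally show "Poly_Mapping.lookup (lin gen p) k = Poly_Mapping.lookup p k" .
qed

text \<open>Reduces linear claims to basis elements. The case \<open>gen\<close> offers only
  elements of the support of \<open>p\<close>, so facts about the words of \<open>p\<close>, such as
  homogeneity, are available there; the other cases know nothing about supports.\<close>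

lemma free_induct [case_names zero add scal gen]:
  assumes "P 0" and "\<And>x y. P x \<Longrightarrow> P y \<Longrightarrow> P (x + y)" and "\<And>r x. P x \<Longrightarrow> P (scal r x)"
    and "\<And>b. b \<in> Poly_Mapping.keys p \<Longrightarrow> P (gen b)"
  shows "P (p :: 'b \<Rightarrow>\<^sub>0 'r::comm_ring_1)"
proof -
  have "P (\<Sum>b\<in>S. scal (Poly_Mapping.lookup p b) (gen b))" if "S \<subseteq> Poly_Mapping.keys p" for S
    using finite_subset[OF that finite_keys] that
    by (induction S rule: finite_induct) (use assms in auto)
  then have "P (lin gen p)" unfolding lin_def by blast
  then show ?thesis by (simp add: lin_gen_id)
qed

lemma lin_lin: "lin f (lin g p) = lin (\<lambda>b. lin f (g b)) p"
  by (induction p rule: free_induct) auto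

lemma lin_cong: "(\<And>b. b \<in> Poly_Mapping.keys p \<Longrightarrow> f b = g b) \<Longrightarrow> lin f p = lin g p"
  by (simp add: lin_def)

lemma lin_zero_fun: "lin (\<lambda>b. 0) p = 0"
  by (simp add: lin_def)

lemma lin_add_fun: "lin (\<lambda>b. f b + g b) p = lin f p + lin g p"
  by (simp add: lin_def scal.scale_right_distrib sum.distrib)

lemma lin_scal_fun: "lin (\<lambda>b. scal r (f b)) p = scal r (lin f p)"
  by (simp add: lin_def scal.scale_sum_right mult.commute)

lemma keys_lin: "Poly_Mapping.keys (lin f p) \<subseteq> (\<Union>b\<in>Poly_Mapping.keys p. Poly_Mapping.keys (f b))"
  unfolding lin_def using keys_sum keys_scal by fastforce

lemma keys_lin_image:
  "(\<And>b. b \<in> Poly_Mapping.keys p \<Longrightarrow> Poly_Mapping.keys (f b) \<subseteq> S) \<Longrightarrow> Poly_Mapping.keys (lin f p) \<subseteq> S"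
  using keys_lin[of f p] by blast

lemma keys_diff_subset: "Poly_Mapping.keys (p - q) \<subseteq> Poly_Mapping.keys p \<union> Poly_Mapping.keys q"
  for p q :: "'b \<Rightarrow>\<^sub>0 'r::comm_ring_1"
  by (auto simp: in_keys_iff lookup_minus)

lemma lookup_lin_inj:
  assumes "inj_on h (insert b (Poly_Mapping.keys p))"
  shows "Poly_Mapping.lookup (lin (\<lambda>b. gen (h b)) p) (h b) = Poly_Mapping.lookup p b"
proof -
  have "Poly_Mapping.lookup (lin (\<lambda>b. gen (h b)) p) (h b) =
      (\<Sum>c\<in>Poly_Mapping.keys p. if c = b then Poly_Mapping.lookup p c else 0)"
    unfolding lin_def lookup_sum lookup_scal lookup_single
    by (rule sum.cong) (use assms in \<open>auto simp: when_def inj_on_def\<close>)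
  also have "\<dots> = Poly_Mapping.lookup p b" by (simp add: in_keys_iff)
  finally show ?thesis .
qed

lemma lin_relabel_eq_0:
  assumes "inj_on h (Poly_Mapping.keys p)" "lin (\<lambda>b. gen (h b)) p = 0"
  shows "p = 0"
  by (rule poly_mapping_eqI)
    (metis assms in_keys_iff insert_absorb lookup_lin_inj lookup_zero)

text \<open>Replaces membership in a span by a coefficient function on the indices, also when
  \<open>f\<close> is not injective; independence statements can then be applied to that
  function.\<close>

lemma span_gen: "scal.span (f ` S) = {lin f c | c. Poly_Mapping.keys c \<subseteq> S}"
proof
  show "scal.span (f ` S) \<subseteq> {lin f c | c. Poly_Mapping.keys c \<subseteq> S}"
  proof
    fix x assume "x \<in> scal.span (f ` S)"
    then show "x \<in> {lin f c | c. Poly_Mapping.keys c \<subseteq> S}"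
    proof (induction rule: scal.span_induct_alt)
      case base
      show ?case by (auto intro!: exI[of _ 0])
    next
      case (step r y z)
      then obtain s c where sc: "s \<in> S" "y = f s" "z = lin f c" "Poly_Mapping.keys c \<subseteq> S" by auto
      have "scal r y + z = lin f (scal r (gen s) + c)" using sc by simp
      moreover have "Poly_Mapping.keys (scal r (gen s) + c) \<subseteq> S"
        using sc keys_add[of "scal r (gen s)" c] keys_scal[of r "gen s"] by auto
      ultimately show ?case by blast
    qed
  qed
  show "{lin f c | c. Poly_Mapping.keys c \<subseteq> S} \<subseteq> scal.span (f ` S)"
    unfolding lin_def by (force intro: scal.span_sum scal.span_scale scal.span_base)
qed

section \<open>Tensor algebras\<close>

lemma single_Nil_mult: "Poly_Mapping.single [] r * p = scal r (p :: 'b list \<Rightarrow>\<^sub>0 'r::comm_ring_1)"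
  unfolding scal_def by (simp add: mult_map_scale_conv_mult zero_list_def)

lemma scal_mult_left: "scal r p * q = scal r (p * (q :: 'b list \<Rightarrow>\<^sub>0 'r::comm_ring_1))"
  by (simp add: single_Nil_mult[symmetric] mult.assoc)

lemma gen_mult: "gen u * gen v = (gen (u @ v) :: 'b list \<Rightarrow>\<^sub>0 'r::comm_ring_1)"
  by (simp add: mult_single plus_list_def)

lemma gen_Nil: "gen [] = (1 :: 'b list \<Rightarrow>\<^sub>0 'r::comm_ring_1)"
  by (simp flip: single_one add: zero_list_def)

text \<open>Scalars are multiples of the empty word, which is neutral on both sides; with
  commutativity of the ring this makes them central.\<close>

lemma scal_mult_right: "p * scal r q = scal r (p * (q :: 'b list \<Rightarrow>\<^sub>0 'r::comm_ring_1))"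
proof -
  have "p * Poly_Mapping.single [] r = scal r p"
    by (induction p rule: free_induct)
      (auto simp: distrib_right scal.scale_right_distrib scal_mult_left mult_single scal_single plus_list_def mult.commute)
  then show ?thesis
    by (metis mult.assoc scal_mult_left single_Nil_mult)
qed

lemma alg_ext_one: "alg_ext (*) 1 f 1 = 1"
  by (simp add: alg_ext_def flip: gen_Nil)

lemma alg_ext_Cons: "alg_ext mul e f (gen (b # w)) = mul (f b) (alg_ext mul e f (gen w))"
  by (simp add: alg_ext_def)

lemma alg_ext_lin [simp]:
  "alg_ext mul e f 0 = 0"
  "alg_ext mul e f (p + q) = alg_ext mul e f p + alg_ext mul e f q"
  "alg_ext mul e f (scal r p) = scal r (alg_ext mul e f p)"
  "alg_ext mul e f (- p) = - alg_ext mul e f p"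
  "alg_ext mul e f (p - q) = alg_ext mul e f p - alg_ext mul e f q"
  by (simp_all add: alg_ext_def)

lemma alg_ext_gen_append:
  "alg_ext (*) 1 f (gen (u @ v)) =
    alg_ext (*) 1 f (gen u) * (alg_ext (*) 1 f (gen v) :: 'c list \<Rightarrow>\<^sub>0 'r::comm_ring_1)"
  by (induction u) (simp_all add: alg_ext_Cons alg_ext_one gen_Nil mult.assoc)

lemma alg_ext_mult:
  "alg_ext (*) 1 f (p * q) = alg_ext (*) 1 f p * (alg_ext (*) 1 f q :: 'c list \<Rightarrow>\<^sub>0 'r::comm_ring_1)"
proof (induction p rule: free_induct)
  case (gen u)
  show ?case
    by (induction q rule: free_induct)
      (simp_all add: gen_mult alg_ext_gen_append distrib_left scal_mult_right)
qed (simp_all add: distrib_right scal_mult_left)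

lemma alg_ext_letter: "alg_ext (*) 1 f (gen [b]) = (f b :: 'c list \<Rightarrow>\<^sub>0 'r::comm_ring_1)"
  by (simp add: alg_ext_Cons gen_Nil alg_ext_one)

lemma alg_ext_relabel:
  "alg_ext (*) 1 (\<lambda>b. gen [h b]) (gen w) = (gen (map h w) :: 'c list \<Rightarrow>\<^sub>0 'r::comm_ring_1)"
  by (induction w) (simp_all add: alg_ext_Cons alg_ext_one gen_mult gen_Nil)

lemma koszul_simps [simp]:
  "koszul n 0 = 0" "koszul n (p + q) = koszul n p + koszul n q"
  "koszul n (scal r p) = scal r (koszul n p)" "lin f (koszul n p) = koszul n (lin f p)"
  "koszul n (koszul m p) = koszul (n + m) p" "koszul 0 p = p"
  by (simp_all add: koszul_def scal.scale_right_distrib mult.commute power_add)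

lemma koszul_mult:
  "koszul n x * y = koszul n (x * (y :: 'b list \<Rightarrow>\<^sub>0 'r::comm_ring_1))"
  "x * koszul n y = koszul n (x * (y :: 'b list \<Rightarrow>\<^sub>0 'r::comm_ring_1))"
  by (simp_all add: koszul_def scal_mult_left scal_mult_right)

lemma keys_koszul: "Poly_Mapping.keys (koszul n p) \<subseteq> Poly_Mapping.keys p"
  by (simp add: koszul_def keys_scal)

lemma tens_simps [simp]:
  "tens 0 y = 0" "tens x 0 = 0"
  "tens (x + x') y = tens x y + tens x' y" "tens x (y + y') = tens x y + tens x y'"
  "tens (scal r x) y = scal r (tens x y)" "tens x (scal r y) = scal r (tens x y)"
  "tens (gen b) (gen c) = gen (b, c)"
  by (simp_all add: tens_def lin_zero_fun lin_add_fun lin_scal_fun)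

lemma wdeg_simps [simp]: "wdeg d [] = 0" "wdeg d (b # w) = d b + wdeg d w"
  "wdeg d (u @ v) = wdeg d u + wdeg d v"
  by (simp_all add: wdeg_def)

lemma gcomm_simps [simp]:
  "gcomm d 0 y = 0" "gcomm d x 0 = 0"
  "gcomm d (x + x') y = gcomm d x y + gcomm d x' y" "gcomm d x (y + y') = gcomm d x y + gcomm d x y'"
  "gcomm d (scal r x) y = scal r (gcomm d x y)" "gcomm d x (scal r y) = scal r (gcomm d x y)"
  by (simp_all add: gcomm_def lin_zero_fun lin_add_fun lin_scal_fun)

lemma gcomm_gen:
  "gcomm d (gen u) (gen v) =
    gen (u @ v) - koszul (wdeg d u * wdeg d v) (gen (v @ u) :: 'b list \<Rightarrow>\<^sub>0 'r::comm_ring_1)"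
  by (simp add: gcomm_def gen_mult)

section \<open>Simplices of suspensions\<close>

lemma simp_susp:
  "simp (susp X) n = insert None {susp_simplex X (n - i) i x | i x. 1 \<le> i \<and> i \<le> n \<and> x \<in> simp X (n - i)}"
  by (simp add: susp_def)

lemma None_in_simp_susp [simp]: "None \<in> simp (susp X) n"
  by (simp add: simp_susp)

lemma susp_sel [simp]:
  "face (susp X) n j None = None"
  "face (susp X) n j (Some (i, x)) = (if j < i then (if i = 1 then None else Some (i - 1, x))
           else if n = i then None
           else susp_simplex X (n - i - 1) i (face X (n - i) (j - i) x))"
  "degen (susp X) n j None = None"
  "degen (susp X) n j (Some (i, x)) = (if j < i then Some (i + 1, x)
           else susp_simplex X (n - i + 1) i (degen X (n - i) (j - i) x))"
  by (simp_all add: susp_def)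

lemma sprod_sel [simp]:
  "simp (sprod X Y) n = simp X n \<times> simp Y n"
  "face (sprod X Y) n i (x, y) = (face X n i x, face Y n i y)"
  "degen (sprod X Y) n i (x, y) = (degen X n i x, degen Y n i y)"
  by (simp_all add: sprod_def)

lemma base_susp [simp]: "base (susp X) n = None"
  by (induction n) (auto simp: simp_susp)

lemma Some_in_simp_susp:
  "Some (i, x) \<in> simp (susp X) n \<longleftrightarrow> 1 \<le> i \<and> i \<le> n \<and> x \<in> simp X (n - i) \<and> x \<noteq> base X (n - i)"
  by (auto simp: simp_susp susp_simplex_def split: if_splits)

text \<open>Collects the properties of base points used below. They hold for \<open>susp X\<close>
  whatever \<open>X\<close> is, so the double suspension can be treated without checking the
  simplicial identities in a suspension.\<close>

definition based :: "'a sset \<Rightarrow> bool" where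
  "based X \<longleftrightarrow> reduced X \<and> (\<forall>n. base X n \<in> simp X n) \<and>
     (\<forall>n j. j \<le> n \<longrightarrow> degen X n j (base X n) = base X (Suc n))"

lemma (in simplicial_set) based:
  assumes "reduced X"
  shows "based X"
proof -
  have base: "base X n \<in> simp X n" for n
  proof (induction n)
    case 0
    from assms obtain v where "simp X 0 = {v}" unfolding reduced_def by blast
    then show ?case by (simp add: base.simps)
  next
    case (Suc n)
    then show ?case by (simp add: degen_closed base.simps)
  qed
  moreover have "degen X n j (base X n) = base X (Suc n)" if "j \<le> n" for n j
    using that
  proof (induction n arbitrary: j)
    case (Suc n)
    show ?case
    proof (cases j)
      case (Suc j')
      then show ?thesis
        using degen_degen[OF base, of 0 j' n] Suc.IH[of j'] Suc.prems by (simp add: base.simps)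
    qed (simp add: base.simps)
  qed (simp add: base.simps)
  ultimately show ?thesis using assms unfolding based_def by blast
qed

lemma based_susp: "based (susp X)"
  by (simp add: based_def reduced_def simp_susp)

text \<open>For \<open>i \<ge> 2\<close> the simplex \<open>(i, x)\<close> is
  \<open>s_0 (i - 1, x)\<close>, while degeneracies of \<open>(1, y)\<close> of positive index are
  cones over degeneracies of \<open>y\<close>. This is the isomorphism of \<open>s^-1 C_+EX\<close>
  with \<open>C_+X\<close> on bases.\<close>

lemma pos_basis_susp:
  assumes X: "based X"
  shows "pos_basis (susp X) = (\<lambda>(n, x). (Suc n, Some (1, x))) ` pos_basis X"
proof (intro equalityI subsetI)
  fix c assume "c \<in> pos_basis (susp X)"
  then obtain m z where c: "c = (Suc m, z)" and z: "nondegenerate (susp X) (Suc m) z"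
    by (auto simp: pos_basis_def gr0_conv_Suc)
  have *: "z \<in> simp (susp X) (Suc m)" "\<And>j y. j \<le> m \<Longrightarrow> y \<in> simp (susp X) m \<Longrightarrow> z \<noteq> degen (susp X) m j y"
    using z by (auto simp: nondegenerate_def)
  have "z \<noteq> None" using *(2)[of 0 None] by auto
  then obtain i x where zx: "z = Some (i, x)" by auto
  have x: "1 \<le> i" "i \<le> Suc m" "x \<in> simp X (Suc m - i)" "x \<noteq> base X (Suc m - i)"
    using *(1) unfolding zx Some_in_simp_susp by auto
  have i: "i = 1"
  proof (rule ccontr)
    assume "i \<noteq> 1"
    then have "i - 1 \<noteq> 0" "Suc m - i = m - (i - 1)" using x by auto
    then have "Some (i - 1, x) \<in> simp (susp X) m"
      using x unfolding Some_in_simp_susp by auto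
    from *(2)[OF _ this, of 0] zx \<open>i - 1 \<noteq> 0\<close> show False by auto
  qed
  \<comment> \<open>In dimension 1 the cone would be over the only vertex, hence collapsed to the
    base point.\<close>
  have "m \<noteq> 0"
  proof
    assume "m = 0"
    moreover obtain v where "simp X 0 = {v}" using X unfolding based_def reduced_def by blast
    ultimately show False using x i by (simp add: base.simps)
  qed
  have "nondegenerate X m x"
    unfolding nondegenerate_def
  proof (intro conjI allI impI)
    fix m' j y assume h: "m = Suc m' \<and> j \<le> m' \<and> y \<in> simp X m'"
    show "x \<noteq> degen X m' j y"
    proof
      assume xy: "x = degen X m' j y"
      have "x \<noteq> base X (Suc m')" using x i h by simp
      then have "y \<noteq> base X m'" using X h unfolding xy based_def by blast
      then have "Some (1, y) \<in> simp (susp X) m" unfolding Some_in_simp_susp using h by simp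
      from *(2)[OF _ this, of "Suc j"] h xy zx i x show False
        by (auto simp: susp_simplex_def simp del: base.simps)
    qed
  qed (use x i in simp)
  then show "c \<in> (\<lambda>(n, x). (Suc n, Some (1, x))) ` pos_basis X"
    using c zx i \<open>m \<noteq> 0\<close> by (auto simp: pos_basis_def)
next
  fix c assume "c \<in> (\<lambda>(n, x). (Suc n, Some (1 :: nat, x))) ` pos_basis X"
  then obtain n x where c: "c = (Suc n, Some (1, x))" "n > 0" and x: "nondegenerate X n x"
    by (auto simp: pos_basis_def)
  obtain m where n: "n = Suc m" using c by (cases n) auto
  \<comment> \<open>Base points of positive dimension are degenerate, so a nondegenerate
    \<open>x\<close> is not one and \<open>(1, x)\<close> is not collapsed.\<close>
  have "base X m \<in> simp X m" using X unfolding based_def by blast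
  then have "x \<noteq> base X n"
    using x by (auto simp: nondegenerate_def n)
  then have "Some (1, x) \<in> simp (susp X) (Suc n)"
    using x unfolding Some_in_simp_susp by (simp add: nondegenerate_def)
  moreover have "Some (1, x) \<noteq> degen (susp X) n j z" if "j \<le> n" "z \<in> simp (susp X) n" for j z
  proof
    assume h: "Some (1, x) = degen (susp X) n j z"
    then obtain i y where z: "z = Some (i, y)" by (cases z) auto
    then have y: "1 \<le> i" "i \<le> n" "y \<in> simp X (n - i)"
      using that(2) unfolding z Some_in_simp_susp by auto
    have i: "i = 1" "j \<ge> 1" "x = degen X m (j - 1) y"
      using h z y n by (auto simp: susp_simplex_def split: if_splits)
    have "j - 1 \<le> m" "y \<in> simp X m" using that y n i(1) by auto
    then show False using x n i(3) unfolding nondegenerate_def by blast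
  qed
  ultimately show "c \<in> pos_basis (susp X)"
    using c by (auto simp: pos_basis_def nondegenerate_def)
qed

text \<open>
  The simplices \<open>None\<close> and \<open>Some (1, x)\<close> are those in which the cone vertex occurs at most once;
  all their faces not containing the vertex \<open>0\<close> are trivial.
\<close>

definition cone_once :: "(nat \<times> 'a) option \<Rightarrow> bool" where
  "cone_once z \<longleftrightarrow> (\<forall>i x. z = Some (i, x) \<longrightarrow> i = 1)"

text \<open>The base point satisfies both predicates, so pairs with one trivial component need no
  separate treatment.\<close>

definition cone_repeated :: "(nat \<times> 'a) option \<Rightarrow> bool" where
  "cone_repeated z \<longleftrightarrow> (\<forall>i x. z = Some (i, x) \<longrightarrow> 2 \<le> i)"

lemma cone_once_simps [simp]:
  "cone_once None" "cone_once (Some (i, x)) \<longleftrightarrow> i = 1" "cone_once (susp_simplex X m (Suc 0) x)"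
  by (simp_all add: cone_once_def susp_simplex_def)

lemma cone_repeated_simps [simp]:
  "cone_repeated None" "cone_repeated (Some (i, x)) \<longleftrightarrow> 2 \<le> i"
  "2 \<le> i \<Longrightarrow> cone_repeated (susp_simplex X m i x)"
  by (simp_all add: cone_repeated_def susp_simplex_def)

lemma cone_once_face: "cone_once z \<Longrightarrow> 1 \<le> j \<Longrightarrow> cone_once (face (susp X) n j z)"
  by (cases z) (auto split: prod.splits)

lemma cone_once_face_0: "cone_once z \<Longrightarrow> face (susp X) n 0 z = None"
  by (cases z) (auto split: prod.splits)

lemma cone_once_degen: "cone_once z \<Longrightarrow> 1 \<le> j \<Longrightarrow> cone_once (degen (susp X) n j z)"
  by (cases z) (auto split: prod.splits)

text \<open>The bound on \<open>j\<close> is sharp, as \<open>d_1 (2, x) = (1, x)\<close>. For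
  \<open>2 \<le> j < i\<close> the multiplicity drops only to \<open>i - 1 \<ge> 2\<close>; for
  \<open>j \<ge> i\<close> it is unchanged or the face is trivial.\<close>

lemma cone_repeated_face: "cone_repeated z \<Longrightarrow> 2 \<le> j \<Longrightarrow> cone_repeated (face (susp X) n j z)"
  by (cases z) (auto split: prod.splits)

lemma cone_repeated_degen: "cone_repeated z \<Longrightarrow> cone_repeated (degen (susp X) n j z)"
  by (cases z) (auto split: prod.splits)

lemma iterated_None [simp]:
  "last_faces (susp X) m j None = None" "rep_face (susp X) k m p None = None"
  "degens (susp X) m is None = None"
  by (induction j arbitrary: m, simp_all) (induction p arbitrary: m, simp_all, induction "is" arbitrary: m, simp_all)

text \<open>The operators applied are \<open>d_m\<close>, ..., \<open>d_(m-j+1)\<close>, so for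
  \<open>j \<le> m\<close> the vertex 0 is never removed.\<close>

lemma cone_once_last_faces: "cone_once z \<Longrightarrow> j \<le> m \<Longrightarrow> cone_once (last_faces (susp X) m j z)"
  by (induction j arbitrary: m z) (simp_all add: cone_once_face)

lemma cone_once_rep_face: "cone_once z \<Longrightarrow> 1 \<le> k \<Longrightarrow> cone_once (rep_face (susp X) k m p z)"
  by (induction p arbitrary: m z) (simp_all add: cone_once_face)

lemma cone_once_degens:
  "cone_once z \<Longrightarrow> (\<And>i. i \<in> set is \<Longrightarrow> 1 \<le> i) \<Longrightarrow> cone_once (degens (susp X) m is z)"
  by (induction "is" arbitrary: m z) (simp_all add: cone_once_degen)

lemma cone_repeated_last_faces:
  "cone_repeated z \<Longrightarrow> j < m \<Longrightarrow> cone_repeated (last_faces (susp X) m j z)"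
  by (induction j arbitrary: m z) (simp_all add: cone_repeated_face)

lemma cone_repeated_degens: "cone_repeated z \<Longrightarrow> cone_repeated (degens (susp X) m is z)"
  by (induction "is" arbitrary: m z) (simp_all add: cone_repeated_degen)

lemma rep_face_0_cone_once: "cone_once z \<Longrightarrow> 0 < p \<Longrightarrow> rep_face (susp X) 0 m p z = None"
  by (cases p) (simp_all add: cone_once_face_0)

lemma last_faces_cone_once: "cone_once z \<Longrightarrow> 0 < m \<Longrightarrow> last_faces (susp X) m m z = None"
proof (induction m arbitrary: z)
  case (Suc m)
  show ?case
  proof (cases m)
    case 0
    then show ?thesis using Suc.prems by (cases z) auto
  next
    case (Suc m')
    then show ?thesis
      using Suc.IH[of "face (susp X) (Suc m) (Suc m) z"] Suc.prems
        cone_once_face[of z "Suc m" X "Suc m"] by simp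
  qed
qed simp

lemma rep_face_sprod:
  "rep_face (sprod X Y) k m p (x, y) = (rep_face X k m p x, rep_face Y k m p y)"
  by (induction p arbitrary: m x y) simp_all

section \<open>Degenerate simplices and pairs in the normalized chains\<close>

lemma nchain_degen:
  "y \<in> simp X m \<Longrightarrow> i \<le> m \<Longrightarrow> nchain X (Suc m) (degen X m i y) = 0"
  unfolding nchain_def nondegenerate_def by auto

lemma nchain_susp_None: "0 < m \<Longrightarrow> nchain (susp X) m None = 0"
  by (cases m) (use nchain_degen[of None "susp X" _ 0] in auto)

lemma nchain_sprod_None: "0 < m \<Longrightarrow> nchain (sprod (susp X) (susp Y)) m (None, None) = 0"
  by (cases m) (use nchain_degen[of "(None, None)" "sprod (susp X) (susp Y)" _ 0] in auto)

lemma cone_repeated_degenerate: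
  assumes z: "cone_repeated z" "z \<in> simp (susp X) (Suc m)"
  shows "\<exists>y \<in> simp (susp X) m. z = degen (susp X) m 0 y"
proof (cases z)
  case None
  then show ?thesis by (intro bexI[of _ None]) auto
next
  case (Some c)
  then obtain i x where i: "z = Some (i, x)" "2 \<le> i"
    using z by (metis cone_repeated_simps(2) surj_pair)
  have "Suc m - i = m - (i - 1)" using i by auto
  then have "Some (i - 1, x) \<in> simp (susp X) m"
    using z(2) i unfolding i(1) Some_in_simp_susp by auto
  then show ?thesis using i by (intro bexI[of _ "Some (i - 1, x)"]) auto
qed

text \<open>A pair is degenerate in a product only through a common degeneracy; when both cone
  vertices are repeated, \<open>s_0\<close> is one.\<close>

lemma nchain_cone_repeated:
  assumes "cone_repeated a" "cone_repeated b"
  shows "nchain (sprod (susp X) (susp Y)) (Suc m) (a, b) = 0"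
proof -
  have "\<not> nondegenerate (sprod (susp X) (susp Y)) (Suc m) (a, b)"
  proof
    assume h: "nondegenerate (sprod (susp X) (susp Y)) (Suc m) (a, b)"
    then have "a \<in> simp (susp X) (Suc m)" "b \<in> simp (susp Y) (Suc m)"
      unfolding nondegenerate_def sprod_sel by simp_all
    then obtain y y' where "y \<in> simp (susp X) m" "a = degen (susp X) m 0 y"
        "y' \<in> simp (susp Y) m" "b = degen (susp Y) m 0 y'"
      using cone_repeated_degenerate[OF assms(1)] cone_repeated_degenerate[OF assms(2)] by blast
    then show False using h unfolding nondegenerate_def
      by (metis SigmaI le0 sprod_sel(1,3))
  qed
  then show ?thesis by (simp add: nchain_def)
qed

section \<open>The diagonal of a double suspension is primitive\<close>

definition cones_once :: "((nat \<times> 'a) option \<times> (nat \<times> 'b) option) simplex \<Rightarrow> bool" where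
  "cones_once \<sigma> \<longleftrightarrow> cone_once (fst (snd \<sigma>)) \<and> cone_once (snd (snd \<sigma>))"

text \<open>Each term has a back factor of dimension \<open>n - p > 0\<close> to which
  \<open>d_0\<close> has been applied at least once. As \<open>d_0\<close> of a cone is trivial,
  this factor is a degenerate pair of base points.\<close>

lemma reduced_comult_cones_once:
  assumes "cones_once \<sigma>"
  shows "reduced_comult (sprod (susp X) (susp Y)) \<sigma> = 0"
proof -
  obtain n a b where \<sigma>: "\<sigma> = (n, (a, b))" by (metis surj_pair)
  then show ?thesis
    using assms by (auto simp: cones_once_def rep_face_sprod rep_face_0_cone_once nchain_sprod_None
        intro!: sum.neutral)
qed

lemma keys_nchain: "Poly_Mapping.keys (nchain X n x :: _ \<Rightarrow>\<^sub>0 'r::comm_ring_1) \<subseteq> {(n, x)}"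
  by (simp add: nchain_def)

lemma keys_sumE:
  assumes "b \<in> Poly_Mapping.keys (sum f S)"
  obtains i where "i \<in> S" "b \<in> Poly_Mapping.keys (f i)"
  using subsetD[OF keys_sum assms] by blast

declare shuffle_aw.simps [simp del]

lemma keys_shuffle_awE:
  assumes "\<sigma> \<in> Poly_Mapping.keys (shuffle_aw X Y k n (x, y) :: _ \<Rightarrow>\<^sub>0 'r::comm_ring_1)"
  obtains p A where "A \<subseteq> {..<n}" "card A = p"
    "\<sigma> \<in> Poly_Mapping.keys (nchain (sprod X Y) (n + k)
      (degens X (p + k) (map (\<lambda>i. i + k) (sorted_list_of_set ({..<n} - A))) (last_faces X (n + k) (n - p) x),
       degens Y (n - p + k) (map (\<lambda>i. i + k) (sorted_list_of_set A)) (rep_face Y k (n + k) p y))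
      :: _ \<Rightarrow>\<^sub>0 'r)"
  using assms unfolding shuffle_aw.simps
  by (elim keys_sumE) (blast intro: that dest: subsetD[OF keys_koszul])

text \<open>For \<open>k \<ge> 1\<close> all faces and degeneracies involved have positive index, so
  the cone vertex of either component is neither removed nor repeated.\<close>

lemma shuffle_aw_cones_once:
  assumes "cone_once a" "cone_once b" "1 \<le> k"
    and "\<sigma> \<in> Poly_Mapping.keys (shuffle_aw (susp X) (susp Y) k n (a, b) :: _ \<Rightarrow>\<^sub>0 'r::comm_ring_1)"
  shows "cones_once \<sigma>"
proof -
  from assms(4) show ?thesis
  proof (rule keys_shuffle_awE)
    fix p A
    let ?a = "degens (susp X) (p + k) (map (\<lambda>i. i + k) (sorted_list_of_set ({..<n} - A)))
                (last_faces (susp X) (n + k) (n - p) a)"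
    let ?b = "degens (susp Y) (n - p + k) (map (\<lambda>i. i + k) (sorted_list_of_set A))
                (rep_face (susp Y) k (n + k) p b)"
    assume A: "A \<subseteq> {..<n}"
      and "\<sigma> \<in> Poly_Mapping.keys (nchain (sprod (susp X) (susp Y)) (n + k) (?a, ?b) :: _ \<Rightarrow>\<^sub>0 'r)"
    then have \<sigma>: "\<sigma> = (n + k, (?a, ?b))"
      using keys_nchain by fast
    have "finite A" using A finite_subset by blast
    then show ?thesis
      unfolding \<sigma> cones_once_def fst_conv snd_conv
      by (intro conjI cone_once_degens cone_once_last_faces cone_once_rep_face)
        (use assms in auto)
  qed
qed

text \<open>At \<open>k \<ge> 1\<close> the recursion involves only \<open>s_k\<close> and derived
  operators of order \<open>k + 1\<close>, so the index 0 never appears.\<close>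

lemma em_derived_cones_once:
  assumes "cone_once a" "cone_once b" "1 \<le> k"
    and "\<sigma> \<in> Poly_Mapping.keys (em_derived (susp X) (susp Y) k n (a, b) :: _ \<Rightarrow>\<^sub>0 'r::comm_ring_1)"
  shows "cones_once \<sigma>"
  using assms(3,4)
proof (induction n arbitrary: k)
  case (Suc n)
  let ?s = "\<lambda>X. degen (susp X) (Suc n + k) k"
  from Suc.prems have "\<sigma> \<in> Poly_Mapping.keys (em_derived (susp X) (susp Y) (Suc k) n (a, b) :: _ \<Rightarrow>\<^sub>0 'r) \<or>
      \<sigma> \<in> Poly_Mapping.keys (shuffle_aw (susp X) (susp Y) (Suc k) (Suc n) (?s X a, ?s Y b) :: _ \<Rightarrow>\<^sub>0 'r)"
    using keys_diff_subset
    by (fastforce simp del: shuffle_aw.simps simp: keys_minus dest!: subsetD[OF keys_add])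
  then show ?case
  proof
    assume "\<sigma> \<in> Poly_Mapping.keys (shuffle_aw (susp X) (susp Y) (Suc k) (Suc n) (?s X a, ?s Y b) :: _ \<Rightarrow>\<^sub>0 'r)"
    then show ?thesis
      by (rule shuffle_aw_cones_once[rotated 3])
        (use assms Suc.prems in \<open>auto intro!: cone_once_degen simp del: susp_sel\<close>)
  qed (use Suc.IH[of "Suc k"] in simp)
qed simp

lemma double_susp_last_faces:
  assumes "\<And>i w. z = Some (i, w) \<Longrightarrow> i = 2 \<and> cone_once w \<and> w \<noteq> None" "3 \<le> m" "m \<le> j + 2"
  shows "last_faces (susp (susp X)) m j z = None"
  using assms
proof (induction j arbitrary: m z)
  case (Suc j)
  let ?z = "face (susp (susp X)) m m z"
  obtain k where k: "m = Suc (Suc (Suc k))"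
    using Suc.prems(2) that[of "m - 3"] by auto
  \<comment> \<open>In dimension 3 the inner simplex has dimension 1 and its last face is the base
    vertex; a nontrivial face therefore forces \<open>3 < m\<close>, as the induction hypothesis
    requires.\<close>
  have z: "3 < m \<and> i = 2 \<and> cone_once w \<and> w \<noteq> None" if "?z = Some (i, w)" for i w
  proof (cases z)
    case (Some c)
    obtain i' w' where c: "c = (i', w')" by fastforce
    with Some Suc.prems(1) have w': "i' = 2" "cone_once w'" "w' \<noteq> None" by auto
    from w' obtain y where "w' = Some (1, y)" by (cases w') auto
    then have "z = Some (2, Some (1, y))" using Some c w' by simp
    then show ?thesis using that by (auto simp: k susp_simplex_def split: if_splits)
  qed (use that in simp)
  show ?case
  proof (cases ?z)
    case (Some c)
    then have "3 < m" using z by (metis surj_pair)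
    then have "last_faces (susp (susp X)) (m - 1) j ?z = None"
      using Suc.IH[of ?z "m - 1"] z Suc.prems(3) by auto
    then show ?thesis by simp
  qed simp
qed simp

text \<open>The argument is \<open>s_0 z\<close> for a nondegenerate \<open>z\<close>. The front
  component has dimension \<open>p + 1\<close> before degeneracies are applied, so it is trivial for
  \<open>p \<le> 1\<close>; the back component is trivial for \<open>p \<ge> 2\<close>. Unless
  \<open>p = 1\<close>, the other component still has a repeated cone vertex and the pair is
  degenerate.\<close>

lemma shuffle_aw_double_susp:
  assumes N: "2 \<le> N"
    and \<sigma>: "\<sigma> \<in> Poly_Mapping.keys (shuffle_aw (susp (susp X)) (susp (susp X)) (Suc 0) N
      (Some (2, Some (1, y)), Some (2, Some (1, y))) :: _ \<Rightarrow>\<^sub>0 'r::comm_ring_1)"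
  shows "cones_once \<sigma>"
proof -
  let ?X = "susp (susp X)" let ?z = "Some (2, Some (1, y))"
  define a where "a p A = degens ?X (p + Suc 0) (map (\<lambda>i. i + Suc 0) (sorted_list_of_set ({..<N} - A)))
                (last_faces ?X (N + Suc 0) (N - p) ?z)" for p A
  define b where "b p A = degens ?X (N - p + Suc 0) (map (\<lambda>i. i + Suc 0) (sorted_list_of_set A))
                (rep_face ?X (Suc 0) (N + Suc 0) p ?z)" for p A
  from \<sigma> obtain p A where A: "A \<subseteq> {..<N}" "card A = p"
      and key: "\<sigma> \<in> Poly_Mapping.keys (nchain (sprod ?X ?X) (Suc N) (a p A, b p A) :: _ \<Rightarrow>\<^sub>0 'r)"
    by (elim keys_shuffle_awE) (auto simp: a_def b_def)
  then have \<sigma>: "\<sigma> = (Suc N, (a p A, b p A))" using keys_nchain by fastforce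
  have fin: "finite A" using A finite_subset by blast
  have rep: "cone_repeated ?z" by simp
  have last: "a p A = None" if "p \<le> 1"
  proof -
    have "last_faces ?X (N + Suc 0) (N - p) ?z = None"
      by (rule double_susp_last_faces) (use N that in auto)
    then show ?thesis by (simp add: a_def)
  qed
  consider "p = 0" | "p = 1" | "2 \<le> p" by linarith
  then show ?thesis
  proof cases
    case 1
    then have "a p A = None" using last by simp
    \<comment> \<open>Here \<open>A\<close> is empty, so neither faces nor degeneracies act on the
      back component.\<close>
    moreover have "b p A = ?z" using 1 A fin by (simp add: b_def)
    ultimately show ?thesis
      using key by (simp add: nchain_cone_repeated)
  next
    case 2
    then have "a p A = None" using last by simp
    \<comment> \<open>The single face is \<open>d_1 s_0 z = z\<close>, and the degeneracies applied
      afterwards have positive index.\<close>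
    moreover have "cone_once (b p A)" unfolding b_def 2
      by (rule cone_once_degens) (auto simp: cone_once_def)
    ultimately show ?thesis by (simp add: \<sigma> cones_once_def)
  next
    case 3
    then obtain q where q: "p = Suc (Suc q)" by (metis add_2_eq_Suc le_Suc_ex)
    \<comment> \<open>The first \<open>d_1\<close> gives \<open>(1, (1, y))\<close>; the second is
      \<open>d_0\<close> on the inner cone \<open>(1, y)\<close>, hence trivial.\<close>
    have "b p A = None" using N by (simp add: b_def q susp_simplex_def)
    moreover have "cone_repeated (a p A)" unfolding a_def
      by (rule cone_repeated_degens, rule cone_repeated_last_faces[OF rep]) simp
    ultimately show ?thesis
      using key by (simp add: nchain_cone_repeated)
  qed
qed

lemma pos_basis_double_suspE:
  assumes "based X" "c \<in> pos_basis (susp (susp X))"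
  obtains n y where "c = (Suc (Suc n), Some (1, Some (1, y)))" "0 < n"
  using assms(2) unfolding pos_basis_susp[OF based_susp] pos_basis_susp[OF assms(1)]
  by (auto simp: pos_basis_def)

lemma em_homotopy_double_susp:
  assumes X: "based X" and c: "(n, z) \<in> pos_basis (susp (susp X))"
    and \<sigma>: "\<sigma> \<in> Poly_Mapping.keys (em_homotopy (susp (susp X)) (susp (susp X)) (n, (z, z)) :: _ \<Rightarrow>\<^sub>0 'r::comm_ring_1)"
  shows "cones_once \<sigma>"
proof -
  let ?X = "susp (susp X)"
  from X c obtain m y where n: "n = Suc (Suc m)" and z: "z = Some (1, Some (1, y))"
    by (auto elim: pos_basis_double_suspE)
  have "\<sigma> \<in> Poly_Mapping.keys (em_derived ?X ?X (Suc 0) (Suc m) (z, z) :: _ \<Rightarrow>\<^sub>0 'r) \<or>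
      \<sigma> \<in> Poly_Mapping.keys (shuffle_aw ?X ?X (Suc 0) n (Some (2, Some (1, y)), Some (2, Some (1, y))) :: _ \<Rightarrow>\<^sub>0 'r)"
    using \<sigma> unfolding em_homotopy.simps n z em_derived.simps(2)[of _ _ 0 "Suc m"]
    by (auto simp: keys_minus numeral_2_eq_2 simp del: em_derived.simps dest!: subsetD[OF keys_add] subsetD[OF keys_diff_subset])
  then show ?thesis
  proof
    assume "\<sigma> \<in> Poly_Mapping.keys (em_derived ?X ?X (Suc 0) (Suc m) (z, z) :: _ \<Rightarrow>\<^sub>0 'r)"
    then show ?thesis by (rule em_derived_cones_once[rotated 3]) (simp_all add: z)
  next
    assume "\<sigma> \<in> Poly_Mapping.keys (shuffle_aw ?X ?X (Suc 0) n (Some (2, Some (1, y)), Some (2, Some (1, y))) :: _ \<Rightarrow>\<^sub>0 'r)"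
    then show ?thesis by (rule shuffle_aw_double_susp[rotated]) (simp add: n)
  qed
qed

section \<open>Vanishing of the higher maps \<open>t_k\<close> and primitivity of the
  letters\<close>

lemma aw_t_double_susp:
  assumes X: "based X" and c: "(n, z) \<in> pos_basis (susp (susp X))"
  shows "aw_t (susp (susp X)) (Suc (Suc k)) (n, (z, z)) = (0 :: _ \<Rightarrow>\<^sub>0 'r::comm_ring_1)"
proof -
  \<comment> \<open>Every summand of \<open>t_k\<close> with \<open>k \<ge> 2\<close> is evaluated
    on this chain, whatever the splitting of \<open>k\<close>, so no induction on \<open>k\<close>
    is needed.\<close>
  have "lin (reduced_comult (sprod (susp (susp X)) (susp (susp X))))
      (em_homotopy (susp (susp X)) (susp (susp X)) (n, (z, z))) = lin (\<lambda>_. 0 :: _ \<Rightarrow>\<^sub>0 'r)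
      (em_homotopy (susp (susp X)) (susp (susp X)) (n, (z, z)))"
    by (rule lin_cong) (metis reduced_comult_cones_once em_homotopy_double_susp[OF X c])
  then show ?thesis by (simp add: lin_zero_fun del: em_homotopy.simps)
qed

lemma aw_diag_double_susp:
  assumes X: "based X" and c: "(n, z) \<in> pos_basis (susp (susp X))"
  shows "aw (susp (susp X)) (susp (susp X)) (n, (z, z)) =
    gen ((0, None), (n, z)) + (gen ((n, z), (0, None)) :: _ \<Rightarrow>\<^sub>0 'r::comm_ring_1)"
proof -
  let ?X = "susp (susp X)"
  have n: "0 < n" and once: "cone_once z"
    using X c by (auto simp: cone_once_def elim: pos_basis_double_suspE)
  define f :: "nat \<Rightarrow> _ \<Rightarrow>\<^sub>0 'r" where "f p = tens (nchain ?X p (last_faces ?X n (n - p) z))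
                                      (nchain ?X (n - p) (rep_face ?X 0 n p z))" for p
  \<comment> \<open>Strictly between 0 and \<open>n\<close> the back face is a base point of
    positive dimension, hence degenerate; only \<open>1 \<otimes> z\<close> and
    \<open>z \<otimes> 1\<close> are left.\<close>
  have "f p = 0" if "p \<in> {..n} - {0, n}" for p
    using that by (simp add: f_def rep_face_0_cone_once[OF once] nchain_susp_None)
  then have "sum f {..n} = sum f {0, n}"
    by (intro sum.mono_neutral_right) auto
  moreover have "nchain ?X 0 None = (gen (0, None) :: _ \<Rightarrow>\<^sub>0 'r)"
    by (simp add: nchain_def nondegenerate_def)
  moreover have "nchain ?X n z = (gen (n, z) :: _ \<Rightarrow>\<^sub>0 'r)"
    using c by (simp add: nchain_def pos_basis_def)
  ultimately show ?thesis
    using n by (simp add: f_def[symmetric])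
      (simp add: f_def rep_face_0_cone_once[OF once] last_faces_cone_once[OF once])
qed

lemma tt_mult_one: "tt_mult d e (gen (u, v)) tt_one = gen (u, v)"
  by (simp add: tt_mult_def)

proposition aw_psi_double_susp:
  assumes X: "based X" and c: "c \<in> pos_basis (susp (susp X))"
  shows "aw_psi (susp (susp X)) (gen [c]) = gen ([c], []) + (gen ([], [c]) :: _ \<Rightarrow>\<^sub>0 'r::comm_ring_1)"
proof -
  let ?X = "susp (susp X)"
  obtain n z where nz: "c = (n, z)" by fastforce
  have n: "0 < n" using c by (simp add: nz pos_basis_def)
  have "(\<lambda>k. aw_t ?X (Suc k) (n, (z, z)) :: _ \<Rightarrow>\<^sub>0 'r) = (\<lambda>k. aw_t ?X (Suc 0) (n, (z, z)) when k = 0)"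
  proof
    fix k show "aw_t ?X (Suc k) (n, (z, z)) = (aw_t ?X (Suc 0) (n, (z, z)) when k = 0 :: _ \<Rightarrow>\<^sub>0 'r)"
      using aw_t_double_susp[OF X c[unfolded nz]] by (cases k) (simp_all only: when_simps simp_thms nat.simps)
  qed
  then have "Sum_any (\<lambda>k. aw_t ?X (Suc k) (n, (z, z)) :: _ \<Rightarrow>\<^sub>0 'r) = aw_t ?X (Suc 0) (n, (z, z))"
    by (simp only: Sum_any_when_equal)
  also have "\<dots> = gen [((0, None), (n, z))] + gen [((n, z), (0, None))]"
    by (simp add: aw_diag_double_susp[OF X c[unfolded nz]] del: aw.simps)
  finally show ?thesis
    using n by (simp add: aw_psi_def aw_Psi_def cobar_diag_def cobar_twist_def milgram_def nz
        alg_ext_letter) (simp add: alg_ext_def tt_mult_one)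
qed

section \<open>A triangular basis of products of iterated commutators\<close>

text \<open>The degree function enters only through signs: triangularity is proved for every
  \<open>d\<close>, coinvariance for \<open>path_deg\<close>.\<close>

definition ad_word :: "('c path_gen \<Rightarrow> nat) \<Rightarrow> 'c list \<Rightarrow> 'c \<Rightarrow> ('c path_gen list \<Rightarrow>\<^sub>0 'r::comm_ring_1)" where
  "ad_word d u c = foldr (\<lambda>v. gcomm d (gen [Orig v])) u (gen [Bar c])"

definition ad_prod :: "('c path_gen \<Rightarrow> nat) \<Rightarrow> ('c list \<times> 'c) list \<Rightarrow> ('c path_gen list \<Rightarrow>\<^sub>0 'r::comm_ring_1)" where
  "ad_prod d \<omega> = prod_list (map (\<lambda>(u, c). ad_word d u c) \<omega>)"

definition std_elt :: "('c path_gen \<Rightarrow> nat) \<Rightarrow> ('c list \<times> 'c) list \<times> 'c list \<Rightarrow> ('c path_gen list \<Rightarrow>\<^sub>0 'r::comm_ring_1)" where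
  "std_elt d = (\<lambda>(\<omega>, u). ad_prod d \<omega> * gen (map Orig u))"

text \<open>This is the leading word of \<open>ad_prod\<close>: each commutator is replaced by its
  term without transpositions.\<close>

definition block_word :: "('c list \<times> 'c) list \<Rightarrow> 'c path_gen list" where
  "block_word \<omega> = concat (map (\<lambda>(u, c). map Orig u @ [Bar c]) \<omega>)"

definition std_word :: "('c list \<times> 'c) list \<times> 'c list \<Rightarrow> 'c path_gen list" where
  "std_word = (\<lambda>(\<omega>, u). block_word \<omega> @ map Orig u)"

lemma ad_prod_simps [simp]:
  "ad_prod d [] = 1" "ad_prod d ((u, c) # \<omega>) = ad_word d u c * ad_prod d \<omega>"
  "ad_prod d (\<omega> @ \<omega>') = ad_prod d \<omega> * ad_prod d \<omega>'"
  by (simp_all add: ad_prod_def)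

lemma block_word_simps [simp]:
  "block_word [] = []" "block_word ((u, c) # \<omega>) = map Orig u @ Bar c # block_word \<omega>"
  by (simp_all add: block_word_def)

lemma std_word_Cons: "std_word ((u, c) # \<omega>, v) = map Orig u @ Bar c # std_word (\<omega>, v)"
  by (simp add: std_word_def)

lemma std_word_Nil: "std_word ([], v) = map Orig v"
  by (simp add: std_word_def)

text \<open>Cutting a word after each \<open>Bar\<close> letter leaves blocks with one
  \<open>Bar\<close> letter each and a final tail of \<open>Orig\<close> letters. Together with
  \<open>inj_std_word\<close> this makes \<open>std_word\<close> a bijection onto all words.\<close>

lemma ex_std_word: "\<exists>i. std_word i = w"
proof (induction w)
  case Nil
  then show ?case by (intro exI[of _ "([], [])"]) (simp add: std_word_def)
next
  case (Cons g w)
  then obtain \<omega> v where w: "std_word (\<omega>, v) = w" by auto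
  show ?case
  proof (cases g)
    case (Bar c)
    then show ?thesis using w by (intro exI[of _ "(([], c) # \<omega>, v)"]) (simp add: std_word_Cons)
  next
    case (Orig c)
    show ?thesis
    proof (cases \<omega>)
      case Nil
      then show ?thesis using w Orig by (intro exI[of _ "([], c # v)"]) (auto simp: std_word_Nil)
    next
      case (Cons b \<omega>')
      moreover obtain u c' where "b = (u, c')" by fastforce
      ultimately show ?thesis
        using w Orig by (intro exI[of _ "((c # u, c') # \<omega>', v)"]) (auto simp: std_word_Cons)
    qed
  qed
qed

lemma Orig_Bar_decomposition:
  "map Orig u @ Bar c # x = map Orig u' @ Bar c' # x' \<longleftrightarrow> u = u' \<and> c = c' \<and> x = x'"
proof (induction u arbitrary: u')
  case Nil
  then show ?case by (cases u') auto
next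
  case (Cons v u)
  then show ?case by (cases u') auto
qed

lemma Orig_Bar_neq: "map Orig v \<noteq> map Orig u @ Bar c # x"
proof
  assume "map Orig v = map Orig u @ Bar c # x"
  then have "Bar c \<in> set (map Orig v)" by simp
  then show False by auto
qed

lemma inj_std_word: "inj std_word"
proof -
  have "std_word (\<omega>, v) = std_word (\<omega>', v') \<Longrightarrow> \<omega> = \<omega>' \<and> v = v'"
    for \<omega> \<omega>' :: "('c list \<times> 'c) list" and v v'
  proof (induction \<omega> arbitrary: \<omega>')
    case Nil
    then show ?case
      by (cases \<omega>') (auto simp: std_word_Nil std_word_Cons Orig_Bar_neq inj_map_eq_map inj_def)
  next
    case (Cons b \<omega>)
    then show ?case
      by (cases \<omega>'; cases b)
        (auto simp: std_word_Nil std_word_Cons Orig_Bar_decomposition Orig_Bar_neq Orig_Bar_neq[symmetric])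
  qed
  then show ?thesis unfolding inj_def by auto
qed

section \<open>Unitriangularity with respect to the number of inversions\<close>

definition origs :: "'c path_gen list \<Rightarrow> nat" where
  "origs w = length (filter (\<lambda>g. \<exists>c. g = Orig c) w)"

definition bars :: "'c path_gen list \<Rightarrow> nat" where
  "bars w = length (filter (\<lambda>g. \<exists>c. g = Bar c) w)"

text \<open>An inversion is an \<open>Orig\<close> letter with a \<open>Bar\<close> letter somewhere
  to its right; in the leading word of a commutator every \<open>Orig\<close> letter contributes
  one.\<close>

fun inversions :: "'c path_gen list \<Rightarrow> nat" where
  "inversions [] = 0"
| "inversions (Orig c # w) = bars w + inversions w"
| "inversions (Bar c # w) = inversions w"

lemma origs_bars_simps [simp]:
  "origs [] = 0" "origs (Orig c # w) = Suc (origs w)" "origs (Bar c # w) = origs w"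
  "bars [] = 0" "bars (Orig c # w) = bars w" "bars (Bar c # w) = Suc (bars w)"
  "origs (x @ y) = origs x + origs y" "bars (x @ y) = bars x + bars y"
  by (simp_all add: origs_def bars_def)

lemma mset_eq_origs_bars:
  assumes "mset x = mset y"
  shows "origs x = origs y" "bars x = bars y"
  unfolding origs_def bars_def using assms by (metis mset_filter size_mset)+

lemma inversions_append: "inversions (x @ y) = inversions x + inversions y + origs x * bars y"
  by (induction x rule: inversions.induct) auto

text \<open>
  In the expansion of an iterated commutator, all words but the leading one arise by moving the \<open>Bar\<close>
  letter to the left.
\<close>

definition lower_words :: "'c path_gen list \<Rightarrow> 'c path_gen list set" where
  "lower_words w = {y. mset y = mset w \<and> inversions y < inversions w}"

text \<open>Asking for coefficient 1 gives a unitriangular system, which can be solved over every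
  commutative ring.\<close>

definition leading :: "('c path_gen list \<Rightarrow>\<^sub>0 'r::comm_ring_1) \<Rightarrow> 'c path_gen list \<Rightarrow> bool" where
  "leading p w \<longleftrightarrow> Poly_Mapping.keys (p - gen w) \<subseteq> lower_words w"

lemma leading_gen: "leading (gen w) w"
  by (simp add: leading_def)

lemma keys_leading:
  fixes p :: "'c path_gen list \<Rightarrow>\<^sub>0 'r::comm_ring_1"
  assumes "leading p w"
  shows "Poly_Mapping.keys p \<subseteq> insert w (lower_words w)"
proof -
  have "p = (p - gen w) + gen w" by simp
  then have "Poly_Mapping.keys p \<subseteq> Poly_Mapping.keys (p - gen w) \<union> Poly_Mapping.keys (gen w :: _ \<Rightarrow>\<^sub>0 'r)"
    by (metis keys_add)
  then show ?thesis using assms by (auto simp: leading_def)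
qed

lemma lookup_leading:
  assumes "leading p w" "inversions w \<le> inversions y"
  shows "Poly_Mapping.lookup p y = (if y = w then 1 else 0)"
proof -
  have "y \<notin> Poly_Mapping.keys (p - gen w)"
    using assms by (auto simp: leading_def lower_words_def)
  then have "Poly_Mapping.lookup (p - gen w) y = 0" by (simp add: in_keys_iff)
  then show ?thesis by (simp add: lookup_minus lookup_single when_def split: if_splits)
qed

text \<open>The mixed term in \<open>inversions_append\<close> depends only on the letters of the
  two factors, so it is the same for all rearrangements, and a drop in one factor is a drop for the
  concatenation.\<close>

lemma append_lower_words:
  assumes "x' \<in> insert x (lower_words x)" "y' \<in> insert y (lower_words y)" "x' \<noteq> x \<or> y' \<noteq> y"
  shows "x' @ y' \<in> lower_words (x @ y)"
  using assms mset_eq_origs_bars[of x' x] mset_eq_origs_bars[of y' y]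
  by (auto simp: lower_words_def inversions_append)

lemma leading_mult:
  fixes p q :: "'c path_gen list \<Rightarrow>\<^sub>0 'r::comm_ring_1"
  assumes "leading p x" "leading q y"
  shows "leading (p * q) (x @ y)"
proof -
  have "p * q - gen (x @ y) = gen x * (q - gen y) + (p - gen x) * q"
    by (simp add: algebra_simps gen_mult)
  moreover have "Poly_Mapping.keys (gen x * (q - gen y)) \<subseteq> lower_words (x @ y)"
  proof
    fix w assume "w \<in> Poly_Mapping.keys (gen x * (q - gen y))"
    then obtain v where "w = x @ v" "v \<in> Poly_Mapping.keys (q - gen y)"
      using keys_mult[of "gen x" "q - gen y"] by (auto simp: plus_list_def)
    moreover from this have "v \<in> lower_words y" "v \<noteq> y"
      using assms(2) by (auto simp: leading_def lower_words_def)
    ultimately show "w \<in> lower_words (x @ y)" using append_lower_words[of x x v y] by simp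
  qed
  moreover have "Poly_Mapping.keys ((p - gen x) * q) \<subseteq> lower_words (x @ y)"
  proof
    fix w assume "w \<in> Poly_Mapping.keys ((p - gen x) * q)"
    then obtain u v where "w = u @ v" "u \<in> Poly_Mapping.keys (p - gen x)" "v \<in> Poly_Mapping.keys q"
      using keys_mult[of "p - gen x" q] by (auto simp: plus_list_def)
    moreover from this have "u \<in> lower_words x" "u \<noteq> x" "v \<in> insert y (lower_words y)"
      using assms(1) keys_leading[OF assms(2)] by (auto simp: leading_def lower_words_def)
    ultimately show "w \<in> lower_words (x @ y)" using append_lower_words[of u x v y] by simp
  qed
  ultimately show ?thesis
    unfolding leading_def using keys_add[of "gen x * (q - gen y)" "(p - gen x) * q"] by auto
qed

lemma gcomm_letter:
  "gcomm d (gen [v]) p =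
    gen [v] * p - lin (\<lambda>y. koszul (d v * wdeg d y) (gen (y @ [v]))) (p :: _ \<Rightarrow>\<^sub>0 'r::comm_ring_1)"
  by (induction p rule: free_induct)
    (simp_all add: distrib_left scal_mult_right scal.scale_right_diff_distrib gcomm_gen gen_mult)

lemma leading_ad_word: "leading (ad_word d u c :: _ \<Rightarrow>\<^sub>0 'r::comm_ring_1) (map Orig u @ [Bar c])"
proof (induction u)
  case Nil
  then show ?case by (simp add: ad_word_def leading_gen)
next
  case (Cons v u)
  let ?a = "ad_word d u c :: _ \<Rightarrow>\<^sub>0 'r" let ?w = "map Orig u @ [Bar c]"
  let ?r = "lin (\<lambda>y. koszul (d (Orig v) * wdeg d y) (gen (y @ [Orig v]))) ?a"
  have "leading (gen [Orig v] * ?a) ([Orig v] @ ?w)"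
    by (intro leading_mult leading_gen Cons.IH)
  moreover have "Poly_Mapping.keys ?r \<subseteq> lower_words ([Orig v] @ ?w)"
  proof (rule keys_lin_image)
    fix y assume "y \<in> Poly_Mapping.keys ?a"
    then have "mset y = mset ?w" "inversions y \<le> inversions ?w"
      using keys_leading[OF Cons.IH] by (auto simp: lower_words_def)
    \<comment> \<open>There is exactly one \<open>Bar\<close> letter, so \<open>Orig v\<close>
      accounts for one inversion at the front and for none at the end.\<close>
    then have "y @ [Orig v] \<in> lower_words ([Orig v] @ ?w)"
      by (simp add: lower_words_def inversions_append)
    then show "Poly_Mapping.keys (koszul (d (Orig v) * wdeg d y) (gen (y @ [Orig v])))
        \<subseteq> lower_words ([Orig v] @ ?w)"
      using keys_koszul by fastforce
  qed
  moreover have "ad_word d (v # u) c - gen ([Orig v] @ ?w) = (gen [Orig v] * ?a - gen ([Orig v] @ ?w)) - ?r"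
    by (simp add: ad_word_def gcomm_letter)
  ultimately have "leading (ad_word d (v # u) c :: _ \<Rightarrow>\<^sub>0 'r) ([Orig v] @ ?w)"
    using order_trans[OF keys_diff_subset Un_least] by (simp only: leading_def)
  then show ?case by simp
qed

lemma leading_ad_prod: "leading (ad_prod d \<omega>) (block_word \<omega>)"
proof (induction \<omega>)
  case Nil
  then show ?case using leading_gen[of "[]"] by (simp add: gen_Nil)
next
  case (Cons b \<omega>)
  then show ?case
    using leading_mult[OF leading_ad_word Cons.IH] by (cases b) simp
qed

lemma leading_std_elt: "leading (std_elt d i) (std_word i)"
  using leading_mult[OF leading_ad_prod leading_gen] by (auto simp: std_elt_def std_word_def split: prod.split)

text \<open>Look at the leading word of an index in the support with the most inversions. Any other
  element of the support has coefficient 0 there: its leading word is different, and its lower words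
  have too few inversions.\<close>

lemma std_elt_independent:
  fixes y :: "_ \<Rightarrow>\<^sub>0 'r::comm_ring_1"
  assumes "lin (std_elt d) y = 0"
  shows "y = 0"
proof (rule ccontr)
  let ?K = "Poly_Mapping.keys y" let ?h = "\<lambda>i. inversions (std_word i)"
  assume "y \<noteq> 0"
  then have K: "finite (?h ` ?K)" "?h ` ?K \<noteq> {}" by simp_all
  obtain i where i: "i \<in> ?K" "?h i = Max (?h ` ?K)" using Max_in[OF K] by auto
  have max: "?h j \<le> ?h i" if "j \<in> ?K" for j
    using Max_ge[OF K(1)] that i by simp
  have "0 = Poly_Mapping.lookup (lin (std_elt d) y) (std_word i)" by (simp add: assms)
  also have "\<dots> = (\<Sum>j\<in>?K. if j = i then Poly_Mapping.lookup y j else 0)"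
    unfolding lin_def lookup_sum lookup_scal
    by (rule sum.cong)
      (auto simp: lookup_leading[OF leading_std_elt max] injD[OF inj_std_word] dest: injD[OF inj_std_word])
  also have "\<dots> = Poly_Mapping.lookup y i" using i by simp
  finally show False using i by (simp add: in_keys_iff)
qed

text \<open>Subtracting the basis element with leading word \<open>w\<close> leaves words with fewer
  inversions. Recording the multiset keeps control of the alphabet and of the degree, which is
  needed for the carrier and for the graded components.\<close>

lemma gen_in_span_std_elt:
  "(gen w :: _ \<Rightarrow>\<^sub>0 'r::comm_ring_1) \<in> scal.span (std_elt d ` {i. mset (std_word i) = mset w})"
proof (induction "inversions w" arbitrary: w rule: less_induct)
  case less
  let ?S = "scal.span (std_elt d ` {i. mset (std_word i) = mset w}) :: (_ \<Rightarrow>\<^sub>0 'r) set"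
  obtain i where i: "std_word i = w" using ex_std_word by blast
  have "lin gen (std_elt d i - gen w :: _ \<Rightarrow>\<^sub>0 'r) \<in> ?S"
    unfolding lin_def
  proof (intro scal.span_sum scal.span_scale)
    fix y assume "y \<in> Poly_Mapping.keys (std_elt d i - gen w :: _ \<Rightarrow>\<^sub>0 'r)"
    then have "mset y = mset w" "inversions y < inversions w"
      using leading_std_elt[of d i] by (auto simp: leading_def i lower_words_def)
    then show "(gen y :: _ \<Rightarrow>\<^sub>0 'r) \<in> ?S" using less[of y] by simp
  qed
  moreover have "std_elt d i \<in> ?S" by (rule scal.span_base) (simp add: i)
  ultimately have "std_elt d i - (std_elt d i - gen w) \<in> ?S"
    unfolding lin_gen_id by (blast intro: scal.span_diff)
  then show ?case by (simp add: algebra_simps)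
qed

lemma in_span_std_elt:
  fixes x :: "_ \<Rightarrow>\<^sub>0 'r::comm_ring_1"
  assumes "\<And>w i. w \<in> Poly_Mapping.keys x \<Longrightarrow> mset (std_word i) = mset w \<Longrightarrow> i \<in> I"
  shows "x \<in> scal.span (std_elt d ` I)"
proof -
  have "gen w \<in> scal.span (std_elt d ` I)" if "w \<in> Poly_Mapping.keys x" for w
    using gen_in_span_std_elt[of w d] scal.span_mono[of "std_elt d ` {i. mset (std_word i) = mset w}" "std_elt d ` I"]
      assms that by blast
  then have "lin gen x \<in> scal.span (std_elt d ` I)"
    unfolding lin_def by (intro scal.span_sum scal.span_scale)
  then show ?thesis by (simp add: lin_gen_id)
qed

lemma wdeg_mset: "mset x = mset y \<Longrightarrow> wdeg d x = wdeg d y"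
  unfolding wdeg_def by (metis mset_map sum_mset_sum_list)

lemma mset_keys_ad_prod:
  "w \<in> Poly_Mapping.keys (ad_prod d \<omega> :: _ \<Rightarrow>\<^sub>0 'r::comm_ring_1) \<Longrightarrow> mset w = mset (block_word \<omega>)"
  using subsetD[OF keys_leading[OF leading_ad_prod]] by (force simp: lower_words_def)

lemma mset_keys_ad_word:
  "w \<in> Poly_Mapping.keys (ad_word d u c :: _ \<Rightarrow>\<^sub>0 'r::comm_ring_1) \<Longrightarrow> mset w = mset (map Orig u @ [Bar c])"
  using subsetD[OF keys_leading[OF leading_ad_word]] by (force simp: lower_words_def)

section \<open>Coinvariants of the coaction\<close>

definition left_mul :: "('b list \<Rightarrow>\<^sub>0 'r::comm_ring_1) \<Rightarrow> ('b list \<times> 'c list \<Rightarrow>\<^sub>0 'r) \<Rightarrow> ('b list \<times> 'c list \<Rightarrow>\<^sub>0 'r)" where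
  "left_mul x = lin (\<lambda>(a, b). tens (x * gen a) (gen b))"

text \<open>This is left multiplication by \<open>1 \<otimes> c\<close>; the sign comes from
  \<open>c\<close> passing the first tensor factor.\<close>

definition right_letter :: "'a simplex \<Rightarrow> ('a simplex path_gen list \<times> 'a simplex list \<Rightarrow>\<^sub>0 'r::comm_ring_1) \<Rightarrow>
    ('a simplex path_gen list \<times> 'a simplex list \<Rightarrow>\<^sub>0 'r)" where
  "right_letter c = lin (\<lambda>(a, b). koszul (cobar_deg c * wdeg path_deg a) (gen (a, c # b)))"

text \<open>The coaction \<open>(1 \<otimes> \<Omega>\<pi>)\<psi>\<close> in the case where all letters are primitive\<close>

primrec coact_word :: "'a simplex path_gen list \<Rightarrow> ('a simplex path_gen list \<times> 'a simplex list \<Rightarrow>\<^sub>0 'r::comm_ring_1)" where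
  "coact_word [] = gen ([], [])"
| "coact_word (g # w) = left_mul (gen [g]) (coact_word w) +
     (case g of Orig c \<Rightarrow> right_letter c (coact_word w) | Bar c \<Rightarrow> 0)"

definition coact :: "('a simplex path_gen list \<Rightarrow>\<^sub>0 'r::comm_ring_1) \<Rightarrow>
    ('a simplex path_gen list \<times> 'a simplex list \<Rightarrow>\<^sub>0 'r)" where
  "coact = lin coact_word"

lemma left_mul_simps [simp]:
  "left_mul x 0 = 0" "left_mul x (z + z') = left_mul x z + left_mul x z'"
  "left_mul x (scal r z) = scal r (left_mul x z)" "left_mul x (koszul n z) = koszul n (left_mul x z)"
  "left_mul x (gen (a, b)) = tens (x * gen a) (gen b)"
  "left_mul x (- z) = - left_mul x z" "left_mul x (z - z') = left_mul x z - left_mul x z'"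
  by (simp_all add: left_mul_def)

lemma left_mul_left [simp]:
  "left_mul 0 z = 0" "left_mul (x + y) z = left_mul x z + left_mul y z"
  "left_mul (scal r x) z = scal r (left_mul x z)"
  by (induction z rule: free_induct; simp add: scal.scale_right_distrib mult.commute distrib_right scal_mult_left split_paired_all)+

lemma left_mul_diff_koszul [simp]:
  "left_mul (x - y) z = left_mul x z - left_mul y z" "left_mul (koszul n x) z = koszul n (left_mul x z)"
proof -
  have "left_mul (x + scal (- 1) y) z = left_mul x z + scal (- 1) (left_mul y z)"
    by (simp only: left_mul_left)
  then show "left_mul (x - y) z = left_mul x z - left_mul y z"
    by (simp only: scal_minus[symmetric] diff_conv_add_uminus)
qed (simp add: koszul_def)

lemma left_mul_tens: "left_mul x (tens p (gen b)) = tens (x * p) (gen b)"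
  by (induction p rule: free_induct) (simp_all add: distrib_left scal_mult_right)

lemma left_mul_mult: "left_mul (x * y) z = left_mul x (left_mul y z)"
  by (induction z rule: free_induct) (auto simp: left_mul_tens mult.assoc)

lemma left_mul_one [simp]: "left_mul 1 z = z"
  by (induction z rule: free_induct) auto

lemma right_letter_simps [simp]:
  "right_letter c 0 = 0" "right_letter c (z + z') = right_letter c z + right_letter c z'"
  "right_letter c (scal r z) = scal r (right_letter c z)"
  "right_letter c (gen (a, b)) = koszul (cobar_deg c * wdeg path_deg a) (gen (a, c # b))"
  "right_letter c (z - z') = right_letter c z - right_letter c z'"
  by (simp_all add: right_letter_def)

lemma coact_simps [simp]:
  "coact 0 = 0" "coact (x + y) = coact x + coact y" "coact (scal r x) = scal r (coact x)"
  "coact (- x) = - coact x" "coact (x - y) = coact x - coact y" "coact (koszul n x) = koszul n (coact x)"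
  "coact (gen w) = coact_word w"
  by (simp_all add: coact_def)

lemma coact_Orig: "coact (gen [Orig c] * y) = left_mul (gen [Orig c]) (coact y) + right_letter c (coact y)"
  by (induction y rule: free_induct)
    (simp_all add: distrib_left scal_mult_right gen_mult scal.scale_right_distrib)

lemma coact_Bar: "coact (gen [Bar c] * y) = left_mul (gen [Bar c]) (coact y)"
  by (induction y rule: free_induct) (simp_all add: distrib_left scal_mult_right gen_mult)

text \<open>The elements \<open>1 \<otimes> c\<close> and \<open>x \<otimes> 1\<close> commute up to
  the Koszul sign, which is the same for all words of \<open>x\<close> by homogeneity.\<close>

lemma right_letter_left_mul:
  assumes "x \<in> homogeneous path_deg n"
  shows "right_letter c (left_mul x z) = koszul (cobar_deg c * n) (left_mul x (right_letter c z))"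
proof (induction x rule: free_induct)
  case (gen w)
  then have w: "wdeg path_deg w = n" using assms by (simp add: homogeneous_def)
  show ?case
    by (induction z rule: free_induct) (auto simp: gen_mult w algebra_simps)
qed simp_all

lemma gcomm_letter_homogeneous:
  assumes "x \<in> homogeneous d n"
  shows "gcomm d (gen [v]) x = gen [v] * x - koszul (d v * n) (x * gen [v])"
proof (induction x rule: free_induct)
  case (gen w)
  then show ?case using assms by (simp add: homogeneous_def gcomm_gen gen_mult)
qed (simp_all add: distrib_left distrib_right scal_mult_left scal_mult_right scal.scale_right_diff_distrib)

text \<open>
  The product form \<open>\<delta>(xy) = (x \<otimes> 1) \<delta>(y)\<close> of coinvariance is closed under products without any
  appeal to multiplicativity of \<open>\<delta>\<close>.
\<close>

definition coinvariant :: "('a simplex path_gen list \<Rightarrow>\<^sub>0 'r::comm_ring_1) \<Rightarrow> bool" where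
  "coinvariant x \<longleftrightarrow> (\<forall>y. coact (x * y) = left_mul x (coact y))"

lemma coinvariant_mult: "coinvariant x \<Longrightarrow> coinvariant y \<Longrightarrow> coinvariant (x * y)"
  by (simp add: coinvariant_def left_mul_mult mult.assoc)

text \<open>Since \<open>1 \<otimes> c\<close> graded commutes with \<open>x \<otimes> 1\<close>,
  one has \<open>[c \<otimes> 1 + 1 \<otimes> c, x \<otimes> 1] = [c, x] \<otimes>
  1\<close>.\<close>

lemma coinvariant_gcomm:
  assumes x: "coinvariant x" "x \<in> homogeneous path_deg n"
  shows "coinvariant (gcomm path_deg (gen [Orig c]) x)"
  unfolding coinvariant_def
proof
  fix y
  have "path_deg (Orig c) = cobar_deg c" by (simp add: cobar_deg_def)
  then show "coact (gcomm path_deg (gen [Orig c]) x * y) = left_mul (gcomm path_deg (gen [Orig c]) x) (coact y)"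
    using x(1) unfolding gcomm_letter_homogeneous[OF x(2)] coinvariant_def
    by (simp add: left_diff_distrib mult.assoc koszul_mult coact_Orig left_mul_mult
        right_letter_left_mul[OF x(2)])
qed

lemma homogeneous_ad_word: "ad_word d u c \<in> homogeneous d (wdeg d (map Orig u @ [Bar c]))"
  unfolding homogeneous_def by (intro CollectI ballI wdeg_mset mset_keys_ad_word)

lemma coinvariant_ad_word: "coinvariant (ad_word path_deg u c)"
proof (induction u)
  case Nil
  then show ?case by (simp add: ad_word_def coinvariant_def coact_Bar)
next
  case (Cons v u)
  then show ?case
    using coinvariant_gcomm[OF Cons.IH homogeneous_ad_word] by (simp add: ad_word_def)
qed

lemma coinvariant_ad_prod: "coinvariant (ad_prod path_deg \<omega>)"
proof (induction \<omega>)
  case Nil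
  then show ?case by (simp add: coinvariant_def)
next
  case (Cons b \<omega>)
  then show ?case by (cases b) (simp add: coinvariant_mult coinvariant_ad_word)
qed

text \<open>The right factor has full length only if every letter has gone to the right. That term
  is \<open>1 \<otimes> u\<close> without a sign, because each letter then passes only the empty
  word.\<close>

lemma coact_map_Orig:
  "Poly_Mapping.keys (coact_word (map Orig u) - gen ([], u) :: _ \<Rightarrow>\<^sub>0 'r::comm_ring_1)
    \<subseteq> {(a, b). length b < length u}"
proof (induction u)
  case (Cons c u)
  define z where "z = (coact_word (map Orig u) - gen ([], u) :: _ \<Rightarrow>\<^sub>0 'r)"
  have "coact_word (map Orig u) = gen ([], u) + z" by (simp add: z_def)
  then have "coact_word (map Orig (c # u)) - gen ([], c # u) =
      gen ([Orig c], u) + (left_mul (gen [Orig c]) z + right_letter c z)"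
    by (simp add: gen_mult)
  moreover have "Poly_Mapping.keys (left_mul (gen [Orig c]) z) \<subseteq> {(a, b). length b < length (c # u)}"
    unfolding left_mul_def using Cons.IH by (fold z_def, intro keys_lin_image) (auto simp: gen_mult)
  moreover have "Poly_Mapping.keys (right_letter c z) \<subseteq> {(a, b). length b < length (c # u)}"
    unfolding right_letter_def using Cons.IH
    by (fold z_def, intro keys_lin_image) (auto dest!: subsetD[OF keys_koszul])
  ultimately show ?case
    by (auto dest!: subsetD[OF keys_add])
qed simp

definition right_component :: "'c list \<Rightarrow> ('b list \<times> 'c list \<Rightarrow>\<^sub>0 'r::comm_ring_1) \<Rightarrow> ('b list \<Rightarrow>\<^sub>0 'r)" where
  "right_component s = lin (\<lambda>(a, b). if b = s then gen a else 0)"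

lemma right_component_simps [simp]:
  "right_component s 0 = 0" "right_component s (z + z') = right_component s z + right_component s z'"
  "right_component s (scal r z) = scal r (right_component s z)"
  "right_component s (gen (a, b)) = (if b = s then gen a else 0)"
  "right_component s (z - z') = right_component s z - right_component s z'"
  by (simp_all add: right_component_def)

lemma right_component_tens: "right_component s (tens p (gen b)) = (if b = s then p else 0)"
  by (induction p rule: free_induct) auto

lemma right_component_left_mul: "right_component s (left_mul x z) = x * right_component s z"
proof (induction z rule: free_induct)
  case (gen k)
  then show ?case by (cases k) (simp add: right_component_tens)
qed (simp_all add: distrib_left scal_mult_right)

lemma right_component_map_Orig:
  assumes "length u \<le> length s"
  shows "right_component s (coact_word (map Orig u)) = (if u = s then 1 else 0)"
proof -
  let ?z = "coact_word (map Orig u) - gen ([], u)"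
  have "right_component s ?z = lin (\<lambda>_. 0) ?z"
    unfolding right_component_def using coact_map_Orig assms by (intro lin_cong) fastforce
  then show ?thesis by (simp add: lin_zero_fun gen_Nil split: if_splits)
qed

lemma coact_std_elt:
  "coact (std_elt path_deg (\<omega>, u)) = left_mul (ad_prod path_deg \<omega>) (coact_word (map Orig u))"
  by (simp add: std_elt_def coinvariant_ad_prod[unfolded coinvariant_def, rule_format])

lemma std_elt_Nil [simp]: "std_elt d (\<omega>, []) = ad_prod d \<omega>"
  by (simp add: std_elt_def gen_Nil)

text \<open>If \<open>s\<close> is at least as long as all tails, the component at \<open>s\<close>
  sees only the basis elements with tail \<open>s\<close> and strips this tail. The outcome is again
  written in the standard basis, so that independence applies to it.\<close>

lemma right_component_coact_lin:
  fixes y :: "_ \<Rightarrow>\<^sub>0 'r::comm_ring_1"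
  assumes "\<And>\<omega> u. (\<omega>, u) \<in> Poly_Mapping.keys y \<Longrightarrow> length u \<le> length s"
  shows "right_component s (coact (lin (std_elt path_deg) y)) =
    lin (std_elt path_deg) (lin (\<lambda>(\<omega>, u). if u = s then gen (\<omega>, []) else 0) y)"
proof -
  have "right_component s (coact (lin (std_elt path_deg) y)) = lin (\<lambda>i. right_component s (coact (std_elt path_deg i))) y"
    by (simp add: coact_def right_component_def lin_lin)
  also have "\<dots> = lin (\<lambda>i. lin (std_elt path_deg) (case i of (\<omega>, u) \<Rightarrow> if u = s then gen (\<omega>, []) else 0)) y"
  proof (rule lin_cong)
    fix i assume i: "i \<in> Poly_Mapping.keys y"
    obtain \<omega> u where wu: "i = (\<omega>, u)" by fastforce
    have "length u \<le> length s" using assms i wu by blast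
    then show "right_component s (coact (std_elt path_deg i)) =
        lin (std_elt path_deg) (case i of (\<omega>, u) \<Rightarrow> if u = s then gen (\<omega>, []) else 0)"
      by (simp add: wu coact_std_elt right_component_left_mul right_component_map_Orig)
  qed
  finally show ?thesis by (simp add: lin_lin)
qed

lemma coact_fixed_imp_no_tail:
  fixes y :: "('a simplex list \<times> 'a simplex) list \<times> 'a simplex list \<Rightarrow>\<^sub>0 'r::comm_ring_1"
  assumes "coact (lin (std_elt path_deg) y) = tens (lin (std_elt path_deg) y) 1"
    and "(\<omega>, u) \<in> Poly_Mapping.keys y"
  shows "u = []"
proof (rule ccontr)
  let ?K = "(\<lambda>(\<omega>, u). length u) ` Poly_Mapping.keys y"
  assume "u \<noteq> []"
  have K: "finite ?K" "?K \<noteq> {}" using assms(2) by auto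
  obtain \<omega>' s where s: "(\<omega>', s) \<in> Poly_Mapping.keys y" "length s = Max ?K"
    using Max_in[OF K] by fastforce
  have max: "length v \<le> length s" if "(\<nu>, v) \<in> Poly_Mapping.keys y" for \<nu> v
    using Max_ge[OF K(1) imageI[OF that]] unfolding s(2) by simp
  have "s \<noteq> []" using max[OF assms(2)] \<open>u \<noteq> []\<close> by auto
  \<comment> \<open>These are the coefficients at a tail of maximal length. As
    \<open>x \<otimes> 1\<close> has no component at a nonempty word, independence makes all of them
    vanish.\<close>
  define y' where "y' = lin (\<lambda>(\<omega>, u). if u = s then gen (\<omega>, [] :: 'a simplex list) else (0 :: _ \<Rightarrow>\<^sub>0 'r)) y"
  have "lin (std_elt path_deg) y' = right_component s (tens (lin (std_elt path_deg) y) (gen []))"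
    using right_component_coact_lin[of y s] max assms(1) by (simp add: y'_def gen_Nil)
  also have "\<dots> = 0" using \<open>s \<noteq> []\<close> by (simp add: right_component_tens)
  finally have "y' = 0" by (rule std_elt_independent)
  have "Poly_Mapping.lookup y' (\<omega>', [] :: 'a simplex list) =
      (\<Sum>i\<in>Poly_Mapping.keys y. if i = (\<omega>', s) then Poly_Mapping.lookup y i else 0)"
    unfolding y'_def lin_def lookup_sum lookup_scal
    by (rule sum.cong) (auto simp: lookup_single when_def split: if_splits)
  also have "\<dots> = Poly_Mapping.lookup y (\<omega>', s)" using s by simp
  finally show False using s \<open>y' = 0\<close> by (simp add: in_keys_iff)
qed

section \<open>The formal coaction agrees with the one defining the model\<close>

lemma tens_map_simps [simp]:
  "tens_map f g 0 = 0" "tens_map f g (x + y) = tens_map f g x + tens_map f g y"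
  "tens_map f g (scal r x) = scal r (tens_map f g x)"
  "tens_map f g (koszul n x) = koszul n (tens_map f g x)"
  "tens_map f g (gen (b, c)) = tens (f (gen b)) (g (gen c))"
  by (simp_all add: tens_map_def)

lemma incl_kappa_simps [simp]:
  "incl_kappa (x + y) = incl_kappa x + incl_kappa y"
  "incl_kappa (gen (u, v)) = koszul (wdeg cobar_deg u) (tens (path_incl (gen u)) (kappa (gen v)))"
  by (simp_all add: incl_kappa_def)

lemma path_incl_gen: "path_incl (gen w) = gen (map Orig w)"
  by (simp add: path_incl_def alg_ext_relabel)

lemma kappa_letter: "kappa (gen []) = 0" "kappa (gen [c]) = - gen [Bar c]"
  by (simp_all add: kappa_def path_incl_gen) (simp add: gen_Nil)

lemma tens_uminus: "tens (- x) y = - tens x y" "tens x (- y) = - tens x y"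
  using tens_simps(5)[of "- 1" x y] tens_simps(6)[of x "- 1" y] by (simp_all only: scal_minus[symmetric])

text \<open>The letter \<open>Bar c\<close> is primitive because \<kappa> vanishes on the unit, and
  the sign of \<kappa> on the letter \<open>c\<close> cancels the one in
  \<open>path_psi\<close>.\<close>

lemma path_psi_letter:
  assumes X: "based X" and c: "c \<in> pos_basis (susp (susp X))" and g: "g = Orig c \<or> g = Bar c"
  shows "path_psi (susp (susp X)) (gen (g # w)) =
    tt_mult path_deg path_deg (gen ([g], []) + (gen ([], [g]) :: _ \<Rightarrow>\<^sub>0 'r::comm_ring_1))
      (path_psi (susp (susp X)) (gen w))"
  using g unfolding path_psi_def alg_ext_Cons
  by (auto simp: aw_psi_double_susp[OF X c] path_incl_gen kappa_letter tens_uminus add.commute)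

lemma tt_mult_letter:
  "tt_mult d e (gen ([g], []) + gen ([], [g'])) z =
    lin (\<lambda>(a, b). gen (g # a, b)) z + lin (\<lambda>(a, b). koszul (e g' * wdeg d a) (gen (a, g' # b)))
      (z :: _ \<Rightarrow>\<^sub>0 'r::comm_ring_1)"
  by (simp add: tt_mult_def)

lemma path_proj_Cons:
  "path_proj (gen (Orig c # b)) = gen [c] * path_proj (gen b)"
  "path_proj (gen (Bar c # b)) = 0"
  by (simp_all add: path_proj_def alg_ext_Cons)

lemma right_letter_tens:
  "right_letter c (tens (gen a) q) = koszul (cobar_deg c * wdeg path_deg a) (tens (gen a) (gen [c] * q))"
  by (induction q rule: free_induct) (simp_all add: distrib_left scal_mult_right gen_mult)

lemma left_mul_tens_gen: "left_mul (gen w) (tens (gen a) q) = tens (gen (w @ a)) q"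
  by (induction q rule: free_induct) (simp_all add: gen_mult)

lemma path_proj_letter:
  fixes z :: "'a simplex path_gen list \<times> 'a simplex path_gen list \<Rightarrow>\<^sub>0 'r::comm_ring_1"
  shows "tens_map id path_proj (lin (\<lambda>(a, b). gen (g # a, b)) z) = left_mul (gen [g]) (tens_map id path_proj z)"
    and "tens_map id path_proj (lin (\<lambda>(a, b). koszul (path_deg g * wdeg path_deg a) (gen (a, g # b))) z) =
      (case g of Orig c \<Rightarrow> right_letter c (tens_map id path_proj z) | Bar c \<Rightarrow> 0)"
  by (induction z rule: free_induct)
    (auto simp: id_def left_mul_tens_gen path_proj_Cons right_letter_tens cobar_deg_def split: path_gen.split)

text \<open>On \<open>path_carrier\<close> all letters come from nondegenerate simplices, and these
  are the letters whose primitivity has been shown.\<close>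

lemma coact_eq:
  assumes X: "based X" and x: "x \<in> path_carrier (susp (susp X))"
  shows "tens_map id path_proj (path_psi (susp (susp X)) x) = coact (x :: _ \<Rightarrow>\<^sub>0 'r::comm_ring_1)"
proof (induction x rule: free_induct)
  case (gen w)
  let ?S = "Orig ` pos_basis (susp (susp X)) \<union> Bar ` pos_basis (susp (susp X))"
  have "w \<in> lists ?S" using x gen unfolding path_carrier_def by blast
  then show ?case
  proof (induction w)
    case Nil
    then show ?case by (simp add: path_psi_def alg_ext_def path_proj_def flip: gen_Nil)
  next
    case (Cons g w)
    let ?z = "path_psi (susp (susp X)) (gen w) :: _ \<Rightarrow>\<^sub>0 'r"
    obtain c where c: "c \<in> pos_basis (susp (susp X))" "g = Orig c \<or> g = Bar c" using Cons by auto
    have IH: "tens_map id path_proj (path_psi (susp (susp X)) (gen w)) = (coact_word w :: _ \<Rightarrow>\<^sub>0 'r)"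
      using Cons.IH by (simp add: id_def)
    show ?case
      unfolding path_psi_letter[OF X c] tt_mult_letter tens_map_simps(2) path_proj_letter IH by simp
  qed
qed (simp_all add: path_psi_def)

section \<open>The carrier of the model as a span of products of commutators\<close>

lemma set_std_word: "set (std_word (\<omega>, u)) \<subseteq> Orig ` S \<union> Bar ` S \<longleftrightarrow> \<omega> \<in> lists (lists S \<times> S) \<and> u \<in> lists S"
proof (induction \<omega>)
  case Nil
  then show ?case by (auto simp: std_word_Nil lists_eq_set)
next
  case (Cons b \<omega>)
  obtain v c where b: "b = (v, c)" by fastforce
  have "Orig ` set v \<subseteq> Orig ` S \<union> Bar ` S \<longleftrightarrow> set v \<subseteq> S" "Bar c \<in> Orig ` S \<union> Bar ` S \<longleftrightarrow> c \<in> S"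
    by auto
  then show ?case using Cons.IH unfolding b std_word_Cons by (simp add: lists_eq_set conj_ac)
qed

text \<open>The condition on multisets says that the products involved have the degrees of words of
  \<open>x\<close>; the comparison of graded components rests on it.\<close>

lemma L2_carrier_in_span:
  fixes x :: "_ \<Rightarrow>\<^sub>0 'r::comm_ring_1"
  assumes X: "based X" and x: "x \<in> L2_carrier (susp (susp X))"
  defines "S \<equiv> pos_basis (susp (susp X))"
  shows "x \<in> scal.span (ad_prod path_deg `
    {\<omega> \<in> lists (lists S \<times> S). \<exists>w \<in> Poly_Mapping.keys x. mset (block_word \<omega>) = mset w})" (is "_ \<in> ?R")
proof -
  have keys: "Poly_Mapping.keys x \<subseteq> lists (Orig ` S \<union> Bar ` S)"
    using x by (simp add: L2_carrier_def path_carrier_def S_def)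
  have fixed: "coact x = tens x 1"
    using x coact_eq[OF X, of x] by (simp add: L2_carrier_def)
  let ?I = "{i \<in> lists (lists S \<times> S) \<times> lists S. \<exists>w \<in> Poly_Mapping.keys x. mset (std_word i) = mset w}"
  have "x \<in> scal.span (std_elt path_deg ` ?I)"
  proof (rule in_span_std_elt)
    fix w i assume w: "w \<in> Poly_Mapping.keys x" "mset (std_word i) = mset w"
    have "w \<in> lists (Orig ` S \<union> Bar ` S)" using keys w(1) by blast
    then have "set (std_word i) \<subseteq> Orig ` S \<union> Bar ` S"
      unfolding mset_eq_setD[OF w(2)] by (simp add: lists_eq_set)
    moreover obtain \<omega> u where "i = (\<omega>, u)" by fastforce
    ultimately have "i \<in> lists (lists S \<times> S) \<times> lists S"
      unfolding mem_Times_iff by (simp only: set_std_word fst_conv snd_conv)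
    then show "i \<in> ?I" using w by blast
  qed
  then obtain y where y: "x = lin (std_elt path_deg) y" "Poly_Mapping.keys y \<subseteq> ?I"
    unfolding span_gen by blast
  have "std_elt path_deg i \<in> ?R" if i: "i \<in> Poly_Mapping.keys y" for i
  proof -
    obtain \<omega> u where wu: "i = (\<omega>, u)" by fastforce
    have "u = []"
      by (rule coact_fixed_imp_no_tail) (use fixed i y(1) wu in auto)
    moreover have "i \<in> ?I" using i y by blast
    ultimately show ?thesis by (auto simp: wu std_word_def intro!: scal.span_base)
  qed
  then show "x \<in> ?R"
    unfolding y(1) lin_def by (intro scal.span_sum scal.span_scale)
qed

proposition L2_carrier_double_susp:
  assumes X: "based X"
  defines "S \<equiv> pos_basis (susp (susp X))"
  shows "(L2_carrier (susp (susp X)) :: (_ \<Rightarrow>\<^sub>0 'r::comm_ring_1) set) =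
    scal.span (ad_prod path_deg ` lists (lists S \<times> S))" (is "?L = ?R")
proof
  show "?L \<subseteq> ?R"
    unfolding S_def
    by (rule subsetI, rule subsetD[OF scal.span_mono L2_carrier_in_span[OF X]]) auto
  show "?R \<subseteq> ?L"
  proof
    fix x :: "_ \<Rightarrow>\<^sub>0 'r" assume "x \<in> ?R"
    then obtain y where x: "x = lin (ad_prod path_deg) y" and y: "Poly_Mapping.keys y \<subseteq> lists (lists S \<times> S)"
      unfolding span_gen by blast
    have "Poly_Mapping.keys x \<subseteq> lists (Orig ` S \<union> Bar ` S)"
      unfolding x
    proof (rule keys_lin_image)
      fix \<omega> assume "\<omega> \<in> Poly_Mapping.keys y"
      then have "set (block_word \<omega>) \<subseteq> Orig ` S \<union> Bar ` S"
        using y set_std_word[of \<omega> "[]" S] by (auto simp: std_word_def)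
      then show "Poly_Mapping.keys (ad_prod path_deg \<omega> :: _ \<Rightarrow>\<^sub>0 'r) \<subseteq> lists (Orig ` S \<union> Bar ` S)"
        by (auto simp: lists_eq_set dest!: mset_keys_ad_prod[THEN mset_eq_setD])
    qed
    then have "x \<in> path_carrier (susp (susp X))" by (simp add: path_carrier_def S_def)
    moreover have "coact x = tens x 1"
      unfolding x
    proof (induction y rule: free_induct)
      case (gen \<omega>)
      \<comment> \<open>Coinvariance is used with the unit as second factor.\<close>
      then show ?case
        using coinvariant_ad_prod[of \<omega>] left_mul_simps(5)[of "ad_prod path_deg \<omega>" "[]" "[]"]
        unfolding coinvariant_def by (metis coact_simps(7) coact_word.simps(1) gen_Nil lin_gen mult.right_neutral)
    qed simp_all
    ultimately show "x \<in> ?L" using coact_eq[OF X, of x] by (simp add: L2_carrier_def)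
  qed
qed

section \<open>Presentations of tensor algebras\<close>

lemma free_algebra_sel [simp]:
  "carrier (free_algebra M) = {p. Poly_Mapping.keys p \<subseteq> lists M}"
  "x \<otimes>\<^bsub>free_algebra M\<^esub> y = x * y" "x \<oplus>\<^bsub>free_algebra M\<^esub> y = x + y"
  "\<one>\<^bsub>free_algebra M\<^esub> = 1" "\<zero>\<^bsub>free_algebra M\<^esub> = 0"
  by (simp_all add: free_algebra_def)

lemma keys_free_algebra:
  fixes p q :: "'m list \<Rightarrow>\<^sub>0 'r::comm_ring_1"
  assumes "Poly_Mapping.keys p \<subseteq> lists M" "Poly_Mapping.keys q \<subseteq> lists M"
  shows "Poly_Mapping.keys (p + q) \<subseteq> lists M" "Poly_Mapping.keys (p - q) \<subseteq> lists M"
    "Poly_Mapping.keys (p * q) \<subseteq> lists M"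
proof -
  show "Poly_Mapping.keys (p + q) \<subseteq> lists M" using assms keys_add[of p q] by blast
  show "Poly_Mapping.keys (p - q) \<subseteq> lists M" using assms keys_diff_subset[of p q] by blast
  have "u @ v \<in> lists M" if "u \<in> Poly_Mapping.keys p" "v \<in> Poly_Mapping.keys q" for u v
    using that assms by auto
  then show "Poly_Mapping.keys (p * q) \<subseteq> lists M"
    using keys_mult[of p q] unfolding plus_list_def by blast
qed

lemma keys_scal_free_algebra:
  "Poly_Mapping.keys p \<subseteq> lists M \<Longrightarrow> Poly_Mapping.keys (scal r p) \<subseteq> lists M"
  using keys_scal[of r p] by blast

lemma ring_free_algebra: "ring (free_algebra M :: ('m list \<Rightarrow>\<^sub>0 'r::comm_ring_1) ring)"
proof (intro ringI abelian_groupI monoidI)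
  fix x :: "'m list \<Rightarrow>\<^sub>0 'r" assume "x \<in> carrier (free_algebra M)"
  then show "\<exists>y\<in>carrier (free_algebra M). y \<oplus>\<^bsub>free_algebra M\<^esub> x = \<zero>\<^bsub>free_algebra M\<^esub>"
    by (intro bexI[of _ "- x"]) (auto simp: keys_minus)
qed (auto simp: keys_free_algebra add_ac mult.assoc distrib_left distrib_right gen_Nil[symmetric]
    simp del: single_one; simp add: gen_Nil)+

text \<open>Zero is homogeneous of every degree, so a word with a letter 0 occurs in several
  degrees; such a word represents 0 in the tensor algebra.\<close>

definition degree_words :: "('b \<Rightarrow> nat) \<Rightarrow> ('b list \<Rightarrow>\<^sub>0 'r::comm_ring_1) set \<Rightarrow> nat \<Rightarrow> ('b list \<Rightarrow>\<^sub>0 'r) list set" where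
  "degree_words deg M n =
     {w. \<exists>ns. list_all2 (\<lambda>m i. m \<in> M \<inter> homogeneous deg i) w ns \<and> sum_list ns = n}"

lemma degree_words_subset: "degree_words deg M n \<subseteq> lists M"
proof
  fix w assume "w \<in> degree_words deg M n"
  then obtain ns where "list_all2 (\<lambda>m i. m \<in> M \<inter> homogeneous deg i) w ns"
    by (auto simp: degree_words_def)
  then show "w \<in> lists M" by (induction rule: list_all2_induct) auto
qed

text \<open>
  Since every element of the free algebra is a combination of words in the family \<open>a\<close> modulo the
  defining ideal of the tensor algebra, independence of the images of these words forces that ideal
  to be the kernel of the map induced by \<open>\<phi>\<close>.
\<close>

locale independent_products =
  fixes a :: "'i \<Rightarrow> ('b list \<Rightarrow>\<^sub>0 'r::comm_ring_1)" and I :: "'i set"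
    and \<phi> :: "('b list \<Rightarrow>\<^sub>0 'r) \<Rightarrow> ('c list \<Rightarrow>\<^sub>0 'r)"
  assumes \<phi>_add: "\<phi> (x + y) = \<phi> x + \<phi> y" and \<phi>_scal: "\<phi> (scal r x) = scal r (\<phi> x)"
    and independent: "\<And>y. Poly_Mapping.keys y \<subseteq> lists I \<Longrightarrow>
      lin (\<lambda>\<omega>. prod_list (map (\<lambda>i. \<phi> (a i)) \<omega>)) y = 0 \<Longrightarrow> y = 0"
begin

definition M :: "('b list \<Rightarrow>\<^sub>0 'r) set" where
  "M = scal.span (a ` I)"

definition F :: "(('b list \<Rightarrow>\<^sub>0 'r) list \<Rightarrow>\<^sub>0 'r) ring" where
  "F = free_algebra M"

definition J :: "(('b list \<Rightarrow>\<^sub>0 'r) list \<Rightarrow>\<^sub>0 'r) set" where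
  "J = tensor_ideal M"

definition ev :: "(('b list \<Rightarrow>\<^sub>0 'r) list \<Rightarrow>\<^sub>0 'r) \<Rightarrow> ('c list \<Rightarrow>\<^sub>0 'r)" where
  "ev = alg_ext (*) 1 \<phi>"

lemma ev_simps [simp]:
  "ev 0 = 0" "ev (p + q) = ev p + ev q" "ev (scal r p) = scal r (ev p)" "ev (p - q) = ev p - ev q"
  "ev 1 = 1" "ev (p * q) = ev p * ev q" "ev (gen [x]) = \<phi> x"
  by (simp_all add: ev_def alg_ext_mult alg_ext_letter alg_ext_one)

lemma ev_lin: "ev (lin f y) = lin (\<lambda>i. ev (f i)) y"
  by (simp add: ev_def alg_ext_def lin_lin)

lemma ev_gen: "ev (gen w) = prod_list (map \<phi> w)"
  by (induction w) (simp_all add: ev_def alg_ext_Cons gen_Nil alg_ext_one)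

lemma M_closed: "x \<in> M \<Longrightarrow> y \<in> M \<Longrightarrow> x + y \<in> M" "x \<in> M \<Longrightarrow> scal r x \<in> M"
  by (simp_all add: M_def scal.span_add scal.span_scale)

lemma carrier_F [simp]: "carrier F = {p. Poly_Mapping.keys p \<subseteq> lists M}"
  by (simp add: F_def)

lemma ideal_J: "ideal J F"
  unfolding J_def F_def tensor_ideal_def
proof (rule ring.genideal_ideal[OF ring_free_algebra], intro subsetI, elim UnE CollectE exE conjE)
  fix p x y assume "p = gen [x + y] - gen [x] - gen [y]" "x \<in> M" "y \<in> M"
  then show "p \<in> carrier (free_algebra M)" by (simp add: keys_free_algebra keys_scal_free_algebra M_closed)
next
  fix p r x assume "p = gen [scal r x] - scal r (gen [x])" "x \<in> M"
  then show "p \<in> carrier (free_algebra M)" by (simp add: keys_free_algebra keys_scal_free_algebra M_closed)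
qed

lemma J_gens:
  "x \<in> M \<Longrightarrow> y \<in> M \<Longrightarrow> gen [x + y] - gen [x] - gen [y] \<in> J"
  "x \<in> M \<Longrightarrow> gen [scal r x] - scal r (gen [x]) \<in> J"
  unfolding J_def tensor_ideal_def genideal_def by blast+

lemma J_carrier: "p \<in> J \<Longrightarrow> Poly_Mapping.keys p \<subseteq> lists M"
  using ideal.Icarr[OF ideal_J] by simp

lemma J_closed:
  "0 \<in> J" "p \<in> J \<Longrightarrow> q \<in> J \<Longrightarrow> p + q \<in> J"
  "p \<in> J \<Longrightarrow> Poly_Mapping.keys q \<subseteq> lists M \<Longrightarrow> q * p \<in> J"
  "p \<in> J \<Longrightarrow> Poly_Mapping.keys q \<subseteq> lists M \<Longrightarrow> p * q \<in> J"
  using additive_subgroup.zero_closed[OF ideal.axioms(1)[OF ideal_J]]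
    additive_subgroup.a_closed[OF ideal.axioms(1)[OF ideal_J], of p q]
    ideal.I_l_closed[OF ideal_J, of p q] ideal.I_r_closed[OF ideal_J, of p q]
  by (simp_all add: F_def)

lemma J_scal:
  assumes "p \<in> J"
  shows "scal r p \<in> J"
proof -
  have "Poly_Mapping.keys (Poly_Mapping.single [] r :: ('b list \<Rightarrow>\<^sub>0 'r) list \<Rightarrow>\<^sub>0 'r) \<subseteq> lists M"
    by simp
  from J_closed(3)[OF assms this] show ?thesis by (simp add: single_Nil_mult)
qed

text \<open>Gives the easy inclusion: the defining ideal is the least one containing the relations,
  and \<open>ev\<close> respects these because \<phi> is linear.\<close>

lemma ideal_kernel: "ideal {p \<in> carrier F. ev p = 0} F"
proof (rule idealI)
  show "ring F" unfolding F_def by (rule ring_free_algebra)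
  show "subgroup {p \<in> carrier F. ev p = 0} (add_monoid F)"
  proof (rule group.subgroupI)
    show "Group.group (add_monoid F)"
      using ring_free_algebra[of M] unfolding F_def
      by (intro abelian_group.a_group ring.is_abelian_group)
    have "a_inv F p = - p" if "Poly_Mapping.keys p \<subseteq> lists M" for p
    proof (rule abelian_group.minus_equality[OF ring.is_abelian_group])
      show "ring F" unfolding F_def by (rule ring_free_algebra)
    qed (use that in \<open>simp_all add: F_def keys_minus\<close>)
    then show "inv\<^bsub>add_monoid F\<^esub> p \<in> {p \<in> carrier F. ev p = 0}" if "p \<in> {p \<in> carrier F. ev p = 0}" for p
      using that ev_simps(4)[of 0 p] unfolding a_inv_def[symmetric] by (simp add: keys_minus del: ev_simps(4))
  qed (auto simp: F_def keys_free_algebra intro: exI[of _ 0])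
qed (auto simp: F_def keys_free_algebra)

lemma ev_J: "p \<in> J \<Longrightarrow> ev p = 0"
proof -
  have "J \<subseteq> {p \<in> carrier F. ev p = 0}"
    unfolding J_def tensor_ideal_def F_def
  proof (rule ring.genideal_minimal[OF ring_free_algebra ideal_kernel[unfolded F_def]],
      intro subsetI, elim UnE CollectE exE conjE)
    fix p :: "('b list \<Rightarrow>\<^sub>0 'r) list \<Rightarrow>\<^sub>0 'r" and x y assume "p = gen [x + y] - gen [x] - gen [y]" "x \<in> M" "y \<in> M"
    then show "p \<in> {p \<in> carrier (free_algebra M). ev p = 0}"
      by (simp add: keys_free_algebra keys_scal_free_algebra M_closed \<phi>_add)
  next
    fix p :: "('b list \<Rightarrow>\<^sub>0 'r) list \<Rightarrow>\<^sub>0 'r" and r x assume "p = gen [scal r x] - scal r (gen [x])" "x \<in> M"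
    then show "p \<in> {p \<in> carrier (free_algebra M). ev p = 0}"
      by (simp add: keys_free_algebra keys_scal_free_algebra M_closed \<phi>_scal)
  qed
  then show "p \<in> J \<Longrightarrow> ev p = 0" by blast
qed

section \<open>Normal forms modulo the defining ideal\<close>

definition N :: "(('b list \<Rightarrow>\<^sub>0 'r) list \<Rightarrow>\<^sub>0 'r) set" where
  "N = scal.span ((\<lambda>\<omega>. gen (map a \<omega>)) ` lists I)"

lemma N_gen: "\<omega> \<in> lists I \<Longrightarrow> gen (map a \<omega>) \<in> N"
  unfolding N_def by (rule scal.span_base) blast

lemma keys_N: "p \<in> N \<Longrightarrow> Poly_Mapping.keys p \<subseteq> lists M"
  unfolding N_def
proof (induction rule: scal.span_induct_alt)
  case (step r x y)
  then have "Poly_Mapping.keys x \<subseteq> lists M" by (auto simp: M_def intro!: scal.span_base)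
  then show ?case using step by (intro keys_free_algebra keys_scal_free_algebra)
qed simp

lemma N_mult:
  assumes "p \<in> N" "q \<in> N"
  shows "p * q \<in> N"
proof -
  have gen: "gen (map a \<omega>) * q \<in> N" if \<omega>: "\<omega> \<in> lists I" for \<omega>
    using assms(2) unfolding N_def
  proof (induction rule: scal.span_induct_alt)
    case base
    then show ?case by (simp add: scal.span_zero)
  next
    case (step r x y)
    then obtain \<omega>' where "\<omega>' \<in> lists I" "x = gen (map a \<omega>')" by auto
    then have "gen (map a \<omega>) * x \<in> scal.span ((\<lambda>\<omega>. gen (map a \<omega>)) ` lists I)"
      using \<omega> N_gen[of "\<omega> @ \<omega>'"] by (simp add: gen_mult N_def)
    then show ?case
      using step by (simp add: distrib_left scal_mult_right scal.span_add scal.span_scale)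
  qed
  from assms(1)[unfolded N_def] show ?thesis
  proof (induction rule: scal.span_induct_alt)
    case base
    then show ?case by (simp add: N_def scal.span_zero)
  next
    case (step r x y)
    then obtain \<omega> where "\<omega> \<in> lists I" "x = gen (map a \<omega>)" by auto
    then show ?case
      using step(2) gen unfolding N_def
      by (simp add: distrib_right scal_mult_left scal.span_add scal.span_scale)
  qed
qed

lemma letter_cong_N:
  assumes "m \<in> M"
  shows "\<exists>q\<in>N. gen [m] - q \<in> J"
proof -
  \<comment> \<open>Membership in \<open>M\<close> is carried along because the relations are
    imposed only on elements of \<open>M\<close>.\<close>
  have "m \<in> M \<and> (\<exists>q\<in>N. gen [m] - q \<in> J)"
    using assms unfolding M_def
  proof (induction rule: scal.span_induct_alt)
    case base
    have "0 \<in> M" by (simp add: M_def scal.span_zero)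
    \<comment> \<open>With scalar 0 the relation says that the letter 0 lies in the ideal.\<close>
    from J_gens(2)[OF this, of 0] show ?case
      by (auto simp: scal.span_zero N_def intro!: bexI[of _ 0])
  next
    case (step r x y)
    then obtain i q where i: "i \<in> I" "x = a i" and q: "q \<in> N" "gen [y] - q \<in> J" and y: "y \<in> M"
      by (auto simp: M_def)
    have x: "x \<in> M" using i by (auto simp: M_def intro: scal.span_base)
    have "gen [x] \<in> N" using N_gen[of "[i]"] i by simp
    then have "scal r (gen [x]) + q \<in> N"
      using q(1) unfolding N_def by (intro scal.span_add scal.span_scale)
    moreover have "gen [scal r x + y] - (scal r (gen [x]) + q) \<in> J"
    proof -
      have "gen [scal r x + y] - (scal r (gen [x]) + q) =
          (gen [scal r x + y] - gen [scal r x] - gen [y]) +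
          ((gen [scal r x] - scal r (gen [x])) + (gen [y] - q))" by simp
      also have "\<dots> \<in> J"
        by (intro J_closed(2) J_gens q M_closed x y)
      finally show ?thesis .
    qed
    ultimately show ?case using M_closed x y by (auto simp: M_def)
  qed
  then show ?thesis by blast
qed

lemma word_cong_N: "w \<in> lists M \<Longrightarrow> \<exists>q\<in>N. gen w - q \<in> J"
proof (induction w)
  case Nil
  then show ?case using N_gen[of "[]"] J_closed(1) by (intro bexI[of _ "gen []"]) auto
next
  case (Cons m w)
  then obtain q q' where q: "q \<in> N" "gen [m] - q \<in> J" "q' \<in> N" "gen w - q' \<in> J"
    using letter_cong_N[of m] by auto
  have "gen (m # w) - q * q' = (gen [m] - q) * gen w + q * (gen w - q')"
    by (simp add: algebra_simps gen_mult)
  also have "\<dots> \<in> J"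
    using Cons.prems by (intro J_closed(2) J_closed(4)[OF q(2)] J_closed(3)[OF q(4)] keys_N[OF q(1)]) auto
  finally show ?case using q N_mult by blast
qed

lemma cong_N:
  assumes "Poly_Mapping.keys p \<subseteq> lists M"
  shows "\<exists>q\<in>N. p - q \<in> J"
proof (induction p rule: free_induct)
  case zero
  then show ?case by (intro bexI[of _ 0]) (simp_all add: J_closed N_def scal.span_zero)
next
  case (add x y)
  then obtain q q' where q: "q \<in> N" "x - q \<in> J" "q' \<in> N" "y - q' \<in> J" by auto
  have "(x - q) + (y - q') \<in> J" by (intro J_closed q)
  then show ?case
    using q by (intro bexI[of _ "q + q'"]) (simp_all add: algebra_simps N_def scal.span_add)
next
  case (scal r x)
  then obtain q where q: "q \<in> N" "x - q \<in> J" by auto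
  then show ?case
    using J_scal[OF q(2), of r] by (intro bexI[of _ "scal r q"]) (simp_all add: scal.scale_right_diff_distrib N_def scal.span_scale)
next
  case (gen w)
  then show ?case using assms by (intro word_cong_N) blast
qed

lemma ev_N_eq_0:
  assumes "q \<in> N" "ev q = 0"
  shows "q = 0"
proof -
  obtain y where y: "q = lin (\<lambda>\<omega>. gen (map a \<omega>)) y" "Poly_Mapping.keys y \<subseteq> lists I"
    using assms(1) unfolding N_def span_gen by blast
  then have "lin (\<lambda>\<omega>. prod_list (map (\<lambda>i. \<phi> (a i)) \<omega>)) y = 0"
    using assms(2) by (simp add: ev_lin ev_gen comp_def)
  then have "y = 0" using y(2) by (rule independent[rotated])
  then show ?thesis by (simp add: y)
qed

lemma kernel_ev:
  assumes "Poly_Mapping.keys p \<subseteq> lists M" "ev p = 0"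
  shows "p \<in> J"
proof -
  obtain q where q: "q \<in> N" "p - q \<in> J" using cong_N assms by blast
  then have "ev q = 0" using ev_J[OF q(2)] assms(2) by simp
  then have "q = 0" by (rule ev_N_eq_0[OF q(1)])
  then show ?thesis using q(2) by simp
qed

lemma ev_image: "ev ` carrier F = scal.span ((\<lambda>\<omega>. prod_list (map (\<lambda>i. \<phi> (a i)) \<omega>)) ` lists I)"
proof -
  have "ev ` carrier F = ev ` N"
  proof
    show "ev ` carrier F \<subseteq> ev ` N"
    proof
      fix x assume "x \<in> ev ` carrier F"
      then obtain p where p: "Poly_Mapping.keys p \<subseteq> lists M" "x = ev p" by (auto simp only: carrier_F)
      then obtain q where "q \<in> N" "p - q \<in> J"
        using cong_N by blast
      then show "x \<in> ev ` N" using ev_J[of "p - q"] p by auto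
    qed
  qed (use keys_N in auto)
  also have "\<dots> = scal.span ((\<lambda>\<omega>. prod_list (map (\<lambda>i. \<phi> (a i)) \<omega>)) ` lists I)"
    unfolding N_def span_gen setcompr_eq_image image_image ev_lin ev_gen by (simp add: comp_def)
  finally show ?thesis .
qed

text \<open>The cosets of the ideal are the fibres of \<open>ev\<close>, so this is the inverse of
  the induced map, written without choosing representatives.\<close>

definition fibre :: "('c list \<Rightarrow>\<^sub>0 'r) \<Rightarrow> (('b list \<Rightarrow>\<^sub>0 'r) list \<Rightarrow>\<^sub>0 'r) set" where
  "fibre x = {p \<in> carrier F. ev p = x}"

lemma fibre_ev:
  assumes "p \<in> carrier F"
  shows "fibre (ev p) = J +>\<^bsub>F\<^esub> p"
proof -
  have "q \<in> fibre (ev p) \<longleftrightarrow> (\<exists>j\<in>J. q = j + p)" for q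
  proof
    assume "q \<in> fibre (ev p)"
    then have "q - p \<in> J" using assms by (intro kernel_ev keys_free_algebra) (auto simp: fibre_def)
    then show "\<exists>j\<in>J. q = j + p" by (intro bexI[of _ "q - p"]) simp_all
  next
    assume "\<exists>j\<in>J. q = j + p"
    then obtain j where "q = j + p" "Poly_Mapping.keys j \<subseteq> lists M" "ev j = 0"
      using J_carrier ev_J by blast
    then show "q \<in> fibre (ev p)"
      using assms by (simp add: fibre_def keys_free_algebra)
  qed
  then show ?thesis by (auto simp: a_r_coset_def' F_def)
qed

lemma tensor_algebra_sel:
  "carrier (tensor_algebra deg M) = fibre ` ev ` carrier F"
  "p \<in> carrier F \<Longrightarrow> q \<in> carrier F \<Longrightarrow>
    fibre (ev p) \<otimes>\<^bsub>tensor_algebra deg M\<^esub> fibre (ev q) = fibre (ev p * ev q)"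
  "p \<in> carrier F \<Longrightarrow> q \<in> carrier F \<Longrightarrow>
    fibre (ev p) \<oplus>\<^bsub>tensor_algebra deg M\<^esub> fibre (ev q) = fibre (ev p + ev q)"
  "\<one>\<^bsub>tensor_algebra deg M\<^esub> = fibre 1"
  "p \<in> carrier F \<Longrightarrow> r \<odot>\<^bsub>tensor_algebra deg M\<^esub> fibre (ev p) = fibre (scal r (ev p))"
  "component (tensor_algebra deg M) n = fibre ` ev ` scal.span (gen ` degree_words deg M n)"
proof -
  have sel: "carrier (tensor_algebra deg M) = carrier (F Quot J)"
    "monoid.mult (tensor_algebra deg M) = monoid.mult (F Quot J)" "add (tensor_algebra deg M) = add (F Quot J)"
    "one (tensor_algebra deg M) = one (F Quot J)"
    "smult (tensor_algebra deg M) r X = (\<Union>x\<in>X. J +>\<^bsub>F\<^esub> scal r x)"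
    "component (tensor_algebra deg M) n = (\<lambda>x. J +>\<^bsub>F\<^esub> x) ` scal.span (gen ` degree_words deg M n)" for X
    by (auto simp: tensor_algebra_def Let_def F_def J_def degree_words_def setcompr_eq_image)
  have carrier: "p * q \<in> carrier F" "p + q \<in> carrier F" "scal r p \<in> carrier F"
    if "p \<in> carrier F" "q \<in> carrier F" for p q
    using that by (auto simp: keys_free_algebra keys_scal_free_algebra)
  show "carrier (tensor_algebra deg M) = fibre ` ev ` carrier F"
    unfolding sel FactRing_def A_RCOSETS_def' using fibre_ev by auto
  show "fibre (ev p) \<otimes>\<^bsub>tensor_algebra deg M\<^esub> fibre (ev q) = fibre (ev p * ev q)"
    if p: "p \<in> carrier F" and q: "q \<in> carrier F"
  proof -
    have "fibre (ev p) \<otimes>\<^bsub>tensor_algebra deg M\<^esub> fibre (ev q) = J +>\<^bsub>F\<^esub> (p * q)"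
      unfolding sel fibre_ev[OF p] fibre_ev[OF q] FactRing_def
      using ideal.rcoset_mult_add[OF ideal_J p q] by (simp add: F_def)
    then show ?thesis using fibre_ev[OF carrier(1)[OF p q]] by simp
  qed
  show "fibre (ev p) \<oplus>\<^bsub>tensor_algebra deg M\<^esub> fibre (ev q) = fibre (ev p + ev q)"
    if p: "p \<in> carrier F" and q: "q \<in> carrier F"
  proof -
    have "fibre (ev p) \<oplus>\<^bsub>tensor_algebra deg M\<^esub> fibre (ev q) = J +>\<^bsub>F\<^esub> (p + q)"
      unfolding sel fibre_ev[OF p] fibre_ev[OF q] FactRing_def
      using ideal.a_rcos_sum[OF ideal_J p q] by (simp add: F_def)
    then show ?thesis using fibre_ev[OF carrier(2)[OF p q]] by simp
  qed
  show "\<one>\<^bsub>tensor_algebra deg M\<^esub> = fibre 1"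
    using fibre_ev[of 1] unfolding sel by (simp add: FactRing_def F_def zero_list_def)
  show "r \<odot>\<^bsub>tensor_algebra deg M\<^esub> fibre (ev p) = fibre (scal r (ev p))" if p: "p \<in> carrier F"
  proof -
    \<comment> \<open>The scalar multiple is a union over a coset. All its members give the same
      coset, and the union is not empty since the fibre is not.\<close>
    have "J +>\<^bsub>F\<^esub> scal r x = fibre (scal r (ev p))" if "x \<in> fibre (ev p)" for x
      using that fibre_ev[OF carrier(3)[of x x]] by (simp add: fibre_def)
    moreover have "fibre (ev p) \<noteq> {}" using p by (auto simp: fibre_def)
    ultimately show ?thesis unfolding sel by auto
  qed
  have "Poly_Mapping.keys x \<subseteq> lists M" if "x \<in> scal.span (gen ` degree_words deg M n)"
    for x :: "('b list \<Rightarrow>\<^sub>0 'r) list \<Rightarrow>\<^sub>0 'r"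
    using that degree_words_subset unfolding span_gen lin_gen_id by blast
  then show "component (tensor_algebra deg M) n = fibre ` ev ` scal.span (gen ` degree_words deg M n)"
    unfolding sel image_image by (intro image_cong) (simp_all add: fibre_ev)
qed

lemma graded_algebra_iso_tensor_algebra:
  fixes A :: "('r, 'c list \<Rightarrow>\<^sub>0 'r) graded_algebra"
  assumes "carrier A = ev ` carrier F" "monoid.mult A = (*)" "one A = 1" "add A = (+)" "smult A = scal"
    and "\<And>n. component A n = ev ` scal.span (gen ` degree_words deg M n)"
  shows "graded_algebra_iso A (tensor_algebra deg M)"
  unfolding graded_algebra_iso_def
proof (intro bexI[of _ fibre] conjI allI ballI)
  show "fibre (r \<odot>\<^bsub>A\<^esub> x) = r \<odot>\<^bsub>tensor_algebra deg M\<^esub> fibre x" if "x \<in> carrier A" for r x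
    using that unfolding assms using tensor_algebra_sel(5) by auto
  show "fibre ` component A n = component (tensor_algebra deg M) n" for n
    unfolding assms tensor_algebra_sel(6) ..
  have "inj_on fibre (ev ` carrier F)"
    by (rule inj_onI) (auto simp: fibre_def)
  then show "fibre \<in> ring_iso A (tensor_algebra deg M)"
    unfolding ring_iso_def ring_hom_def bij_betw_def tensor_algebra_sel(1,4) assms
    using tensor_algebra_sel(2,3) by auto
qed

end

section \<open>Iterated commutators on a double suspension\<close>

definition cone :: "'a simplex \<Rightarrow> (nat \<times> 'a) option simplex" where
  "cone c = (Suc (fst c), Some (1, snd c))"

text \<open>\<open>Orig\<close> lowers the degree by one and \<open>Bar\<close> by two, which is as
  often as the simplex has been coned; so the degrees in \<open>C_+EL\<close> and
  \<open>C_+L\<close> are kept.\<close>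

definition cone_letter :: "(nat \<times> 'a) option simplex + 'a simplex \<Rightarrow>
    (nat \<times> (nat \<times> 'a) option) option simplex path_gen" where
  "cone_letter = case_sum (\<lambda>v. Orig (cone v)) (\<lambda>w. Bar (cone (cone w)))"

definition cone_block :: "(nat \<times> 'a) option simplex list \<times> 'a simplex \<Rightarrow>
    (nat \<times> (nat \<times> 'a) option) option simplex list \<times> (nat \<times> (nat \<times> 'a) option) option simplex" where
  "cone_block = (\<lambda>(u, w). (map cone u, cone (cone w)))"

definition relabel :: "(((nat \<times> 'a) option simplex + 'a simplex) list \<Rightarrow>\<^sub>0 'r::comm_ring_1) \<Rightarrow>
    ((nat \<times> (nat \<times> 'a) option) option simplex path_gen list \<Rightarrow>\<^sub>0 'r)" where
  "relabel = lin (\<lambda>w. gen (map cone_letter w))"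

definition sum_ad :: "'b simplex list \<times> 'c simplex \<Rightarrow> (('b simplex + 'c simplex) list \<Rightarrow>\<^sub>0 'r::comm_ring_1)" where
  "sum_ad = (\<lambda>(u, w). foldr (\<lambda>v. gcomm (sum_deg fst fst) (gen [Inl v])) u (gen [Inr w]))"

lemma inj_cone: "inj cone"
  by (rule injI) (simp add: cone_def prod_eq_iff)

lemma inj_cone_letter: "inj cone_letter"
  by (rule injI) (auto simp: cone_letter_def dest!: injD[OF inj_cone] split: sum.splits)

lemma inj_cone_block: "inj cone_block"
  by (rule injI) (auto simp: cone_block_def inj_map_eq_map[OF inj_cone] dest!: injD[OF inj_cone])

lemma pos_basis_susp_cone: "based X \<Longrightarrow> pos_basis (susp X) = cone ` pos_basis X"
  unfolding pos_basis_susp cone_def case_prod_unfold by simp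

lemma wdeg_cone_letter: "wdeg path_deg (map cone_letter w) = wdeg (sum_deg fst fst) w"
  by (induction w) (auto simp: cone_letter_def cone_def sum_deg_def split: sum.split)

lemma relabel_simps [simp]:
  "relabel 0 = 0" "relabel (x + y) = relabel x + relabel y" "relabel (x - y) = relabel x - relabel y"
  "relabel (scal r x) = scal r (relabel x)" "relabel (koszul n x) = koszul n (relabel x)"
  "relabel (gen w) = gen (map cone_letter w)"
  by (simp_all add: relabel_def)

text \<open>Injectivity of \<open>cone_letter\<close> rules out cancellation, so degrees can also be
  carried back along \<open>relabel\<close>.\<close>

lemma relabel_homogeneous:
  "relabel x \<in> homogeneous path_deg n \<longleftrightarrow> x \<in> homogeneous (sum_deg fst fst) n"
proof -
  have "Poly_Mapping.keys (relabel x) = map cone_letter ` Poly_Mapping.keys x"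
  proof
    show "Poly_Mapping.keys (relabel x) \<subseteq> map cone_letter ` Poly_Mapping.keys x"
      unfolding relabel_def by (rule keys_lin_image) auto
    have "Poly_Mapping.lookup (relabel x) (map cone_letter w) = Poly_Mapping.lookup x w" for w
      unfolding relabel_def
      by (rule lookup_lin_inj) (rule inj_on_subset[OF inj_mapI[OF inj_cone_letter] subset_UNIV])
    then show "map cone_letter ` Poly_Mapping.keys x \<subseteq> Poly_Mapping.keys (relabel x)"
      by (auto simp: in_keys_iff)
  qed
  then show ?thesis by (simp add: homogeneous_def wdeg_cone_letter)
qed

lemma relabel_gcomm: "relabel (gcomm (sum_deg fst fst) x y) = gcomm path_deg (relabel x) (relabel y)"
proof (induction x rule: free_induct)
  case (gen u)
  show ?case
    by (induction y rule: free_induct) (simp_all add: gcomm_gen wdeg_cone_letter)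
qed simp_all

lemma relabel_sum_ad: "relabel (sum_ad (u, w)) = ad_word path_deg (map cone u) (cone (cone w))"
  by (induction u) (simp_all add: sum_ad_def ad_word_def relabel_gcomm cone_letter_def)

lemma prod_relabel_sum_ad:
  "prod_list (map (\<lambda>i. relabel (sum_ad i)) \<omega>) = ad_prod path_deg (map cone_block \<omega>)"
  by (induction \<omega>) (auto simp: relabel_sum_ad cone_block_def)

lemma sum_ad_independent:
  assumes "lin (\<lambda>\<omega>. prod_list (map (\<lambda>i. relabel (sum_ad i)) \<omega>)) y = (0 :: _ \<Rightarrow>\<^sub>0 'r::comm_ring_1)"
  shows "y = 0"
proof -
  have "lin (std_elt path_deg) (lin (\<lambda>\<omega>. gen (map cone_block \<omega>, [])) y) = (0 :: _ \<Rightarrow>\<^sub>0 'r)"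
    using assms by (simp add: lin_lin prod_relabel_sum_ad)
  then have "lin (\<lambda>\<omega>. gen (map cone_block \<omega>, [] :: (nat \<times> (nat \<times> 'a) option) option simplex list)) y = 0"
    by (rule std_elt_independent)
  then show ?thesis
    by (rule lin_relabel_eq_0[rotated]) (auto simp: inj_on_def inj_map_eq_map[OF inj_cone_block])
qed

interpretation ad: independent_products sum_ad "lists A \<times> B" relabel for A B
  by unfold_locales (simp_all add: sum_ad_independent)

lemma linear_part_subset_span:
  "(linear_part S :: ('b list \<Rightarrow>\<^sub>0 'r::comm_ring_1) set) \<subseteq> scal.span ((\<lambda>b. gen [b]) ` S)"
proof
  fix x :: "'b list \<Rightarrow>\<^sub>0 'r" assume "x \<in> linear_part S"
  then have "lin gen x \<in> scal.span (gen ` (\<lambda>b. [b]) ` S)"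
    unfolding span_gen linear_part_def by blast
  then show "x \<in> scal.span ((\<lambda>b. gen [b]) ` S)" by (simp add: lin_gen_id image_image)
qed

text \<open>By multilinearity, iterated commutators of linear combinations are combinations of those
  of letters, and these form an indexed family to which the presentation above applies.\<close>

lemma AN_eq_span:
  "AN fst fst A B = (scal.span (sum_ad ` (lists A \<times> B)) :: (_ \<Rightarrow>\<^sub>0 'r::comm_ring_1) set)"
proof
  let ?T = "scal.span (sum_ad ` (lists A \<times> B)) :: (_ \<Rightarrow>\<^sub>0 'r) set"
  have step: "gcomm (sum_deg fst fst) v z \<in> ?T" if "v \<in> linear_part (Inl ` A)" "z \<in> ?T" for v z
  proof -
    have *: "gcomm (sum_deg fst fst) (gen [Inl b]) z \<in> ?T" if "b \<in> A" for b
      using \<open>z \<in> ?T\<close>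
    proof (induction rule: scal.span_induct_alt)
      case (step r x y)
      then obtain u w where "u \<in> lists A" "w \<in> B" "x = sum_ad (u, w)" by auto
      then have "gcomm (sum_deg fst fst) (gen [Inl b]) x = sum_ad (b # u, w)" "(b # u, w) \<in> lists A \<times> B"
        using that by (simp_all add: sum_ad_def)
      then have "gcomm (sum_deg fst fst) (gen [Inl b]) x \<in> ?T" by (metis imageI scal.span_base)
      then show ?case using step by (simp add: scal.span_add scal.span_scale)
    qed (simp add: scal.span_zero)
    from subsetD[OF linear_part_subset_span that(1)] show ?thesis
    proof (induction rule: scal.span_induct_alt)
      case (step r x y)
      then show ?case using * by (auto intro!: scal.span_add scal.span_scale)
    qed (simp add: scal.span_zero)
  qed
  have base: "w \<in> ?T" if "w \<in> linear_part (Inr ` B)" for w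
  proof -
    have "(\<lambda>b. gen [b]) ` Inr ` B \<subseteq> ?T"
      by (auto simp: sum_ad_def intro!: scal.span_base image_eqI[of _ _ "([], _)"])
    then show ?thesis
      using subsetD[OF linear_part_subset_span that] scal.span_minimal[OF _ scal.subspace_span] by blast
  qed
  have "foldr (gcomm (sum_deg fst fst)) vs w \<in> ?T"
    if "set vs \<subseteq> linear_part (Inl ` A)" "w \<in> linear_part (Inr ` B)" for vs w
    using that(1) by (induction vs) (simp_all add: base[OF that(2)] step)
  then show "AN fst fst A B \<subseteq> ?T"
    unfolding AN_def by (intro scal.span_minimal scal.subspace_span) auto
  have "sum_ad (u, w) = foldr (gcomm (sum_deg fst fst)) (map (\<lambda>v. gen [Inl v]) u) (gen [Inr w])" for u w
    by (simp add: sum_ad_def foldr_map comp_def)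
  moreover have "set (map (\<lambda>v. gen [Inl v]) u) \<subseteq> linear_part (Inl ` A)" "gen [Inr w] \<in> linear_part (Inr ` B)"
    if "(u, w) \<in> lists A \<times> B" for u w
    using that by (auto simp: linear_part_def)
  ultimately show "?T \<subseteq> AN fst fst A B"
    unfolding AN_def by (intro scal.span_mono) blast
qed

lemma homogeneous_closed:
  "0 \<in> homogeneous d n" "x \<in> homogeneous d n \<Longrightarrow> y \<in> homogeneous d n \<Longrightarrow> x + y \<in> homogeneous d n"
  "x \<in> homogeneous d n \<Longrightarrow> scal r x \<in> homogeneous d n"
  using keys_add[of x y] keys_scal[of r x] by (auto simp: homogeneous_def)

lemma homogeneous_mult:
  fixes x y :: "_ \<Rightarrow>\<^sub>0 'r::comm_ring_1"
  assumes "x \<in> homogeneous d m" "y \<in> homogeneous d n"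
  shows "x * y \<in> homogeneous d (m + n)"
  using assms keys_mult[of x y] by (fastforce simp: homogeneous_def plus_list_def)

lemma ev_degree_word:
  assumes "w \<in> degree_words (sum_deg fst fst) M n"
  shows "prod_list (map relabel w) \<in> homogeneous path_deg n"
proof -
  obtain ns where ns: "list_all2 (\<lambda>m i. m \<in> M \<inter> homogeneous (sum_deg fst fst) i) w ns" "sum_list ns = n"
    using assms by (auto simp: degree_words_def)
  from ns(1) have "prod_list (map relabel w) \<in> homogeneous path_deg (sum_list ns)"
    by (induction rule: list_all2_induct)
      (auto simp: homogeneous_mult relabel_homogeneous gen_Nil[symmetric], simp add: homogeneous_def)
  then show ?thesis by (simp add: ns)
qed

lemma sum_ad_homogeneous:
  "sum_ad i \<in> homogeneous (sum_deg fst fst) (wdeg path_deg (block_word [cone_block i]))"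
proof -
  obtain u w where i: "i = (u, w)" by (cases i)
  have "block_word [cone_block i] = map Orig (map cone u) @ [Bar (cone (cone w))]"
    by (simp add: i cone_block_def)
  then show ?thesis
    unfolding relabel_homogeneous[symmetric] i relabel_sum_ad by (simp only: homogeneous_ad_word)
qed

lemma map_sum_ad_degree_words:
  assumes "set \<omega> \<subseteq> I" "sum_ad ` I \<subseteq> M"
  shows "map sum_ad \<omega> \<in> degree_words (sum_deg fst fst) M (wdeg path_deg (block_word (map cone_block \<omega>)))"
  unfolding degree_words_def
proof (intro CollectI exI conjI)
  let ?d = "\<lambda>i. wdeg path_deg (block_word [cone_block i])"
  show "list_all2 (\<lambda>m i. m \<in> M \<inter> homogeneous (sum_deg fst fst) i) (map sum_ad \<omega>) (map ?d \<omega>)"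
    using assms sum_ad_homogeneous by (auto simp: list_all2_map1 list_all2_map2 list_all2_same)
  show "sum_list (map ?d \<omega>) = wdeg path_deg (block_word (map cone_block \<omega>))"
    by (induction \<omega>) (auto simp: block_word_def)
qed

theorem corollary6p8:
  fixes L :: "'a sset"
  assumes R: "(2 :: 'r::idom) dvd 1 \<or> ((\<forall>x::'r. x \<noteq> 0 \<longrightarrow> x dvd 1) \<and> (2 :: 'r) = 0)"
    and L: "simplicial_set L" "reduced L"
  shows "graded_algebra_iso
    (L2 (susp (susp L)) :: ('r, _) graded_algebra)
    (tensor_algebra (sum_deg fst fst) (AN fst fst (pos_basis (susp L)) (pos_basis L)))"
proof -
  have based: "based L" using L by (rule simplicial_set.based)
  let ?A = "pos_basis (susp L)" let ?B = "pos_basis L" let ?S = "pos_basis (susp (susp L))"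
  let ?I = "lists ?A \<times> ?B"
  let ?M = "ad.M ?A ?B :: (_ \<Rightarrow>\<^sub>0 'r) set" let ?W = "degree_words (sum_deg fst fst) ?M"
  have M: "AN fst fst ?A ?B = ?M" by (simp add: AN_eq_span ad.M_def)
  \<comment> \<open>The same simplices serve two purposes: as \<open>Orig\<close> letters they are
    cones over simplices of \<open>EL\<close>, as \<open>Bar\<close> letters they are double cones
    over simplices of \<open>L\<close>.\<close>
  have S: "?S = cone ` ?A" "?S = (\<lambda>w. cone (cone w)) ` ?B"
    using pos_basis_susp_cone[OF based] pos_basis_susp_cone[OF based_susp[of L]] by (simp_all add: image_image)
  have "cone_block ` ?I = lists ?S \<times> ?S"
    unfolding cone_block_def S(1)[THEN arg_cong[of _ _ lists]] lists_image
    by (subst S(2)) (auto simp: image_iff)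
  then have blocks: "map cone_block ` lists ?I = lists (lists ?S \<times> ?S)"
    by (metis lists_image)
  have carrier: "L2_carrier (susp (susp L)) = ad.ev ` carrier (ad.F ?A ?B :: (_ \<Rightarrow>\<^sub>0 'r) ring)"
    unfolding ad.ev_image L2_carrier_double_susp[OF based] prod_relabel_sum_ad
    by (simp add: blocks[symmetric] image_image)
  have component: "L2_carrier (susp (susp L)) \<inter> homogeneous path_deg n = ad.ev ` scal.span (gen ` ?W n)" for n
  proof
    show "L2_carrier (susp (susp L)) \<inter> homogeneous path_deg n \<subseteq> ad.ev ` scal.span (gen ` ?W n)"
    proof
      fix x :: "_ \<Rightarrow>\<^sub>0 'r" assume x: "x \<in> L2_carrier (susp (susp L)) \<inter> homogeneous path_deg n"
      let ?O = "{\<omega> \<in> lists ?I. wdeg path_deg (block_word (map cone_block \<omega>)) = n}"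
      \<comment> \<open>A homogeneous element needs only products whose leading word has its degree,
        by the condition on multisets.\<close>
      have "x \<in> scal.span (ad_prod path_deg ` map cone_block ` ?O)"
      proof (rule subsetD[OF scal.span_mono L2_carrier_in_span[OF based]])
        show "ad_prod path_deg ` {\<omega> \<in> lists (lists ?S \<times> ?S). \<exists>w\<in>Poly_Mapping.keys x. mset (block_word \<omega>) = mset w}
          \<subseteq> ad_prod path_deg ` map cone_block ` ?O"
        proof (intro image_mono subsetI)
          fix \<omega> assume "\<omega> \<in> {\<omega> \<in> lists (lists ?S \<times> ?S). \<exists>w\<in>Poly_Mapping.keys x. mset (block_word \<omega>) = mset w}"
          then obtain w where w: "\<omega> \<in> map cone_block ` lists ?I" "w \<in> Poly_Mapping.keys x" "mset (block_word \<omega>) = mset w"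
            unfolding blocks by blast
          then have "wdeg path_deg (block_word \<omega>) = n"
            using x wdeg_mset by (fastforce simp: homogeneous_def)
          then show "\<omega> \<in> map cone_block ` ?O" using w(1) by blast
        qed
      qed (use x in simp)
      then obtain y where y: "x = lin (\<lambda>\<omega>. ad_prod path_deg (map cone_block \<omega>)) y" "Poly_Mapping.keys y \<subseteq> ?O"
        unfolding image_image span_gen by blast
      have "gen (map sum_ad \<omega>) \<in> scal.span (gen ` ?W n)" if "\<omega> \<in> ?O" for \<omega>
      proof (intro scal.span_base imageI)
        have "sum_ad ` ?I \<subseteq> ?M" unfolding ad.M_def by (rule scal.span_superset)
        then show "map sum_ad \<omega> \<in> ?W n"
          using that map_sum_ad_degree_words[of \<omega> ?I ?M] by auto
      qed
      then have "lin (\<lambda>\<omega>. gen (map sum_ad \<omega>)) y \<in> scal.span (gen ` ?W n)"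
        unfolding lin_def using y(2) by (intro scal.span_sum scal.span_scale) blast
      moreover have "x = ad.ev (lin (\<lambda>\<omega>. gen (map sum_ad \<omega>)) y)"
        unfolding y(1) ad.ev_lin ad.ev_gen by (simp add: prod_relabel_sum_ad comp_def)
      ultimately show "x \<in> ad.ev ` scal.span (gen ` ?W n)" by blast
    qed
    show "ad.ev ` scal.span (gen ` ?W n) \<subseteq> L2_carrier (susp (susp L)) \<inter> homogeneous path_deg n"
    proof (intro subsetI IntI)
      fix x :: "_ \<Rightarrow>\<^sub>0 'r" assume "x \<in> ad.ev ` scal.span (gen ` ?W n)"
      then obtain p where x: "x = ad.ev p" and p: "p \<in> scal.span (gen ` ?W n)" by blast
      from p have "Poly_Mapping.keys p \<subseteq> ?W n" unfolding span_gen lin_gen_id by blast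
      then have "p \<in> carrier (ad.F ?A ?B)"
        using degree_words_subset[of _ ?M n] unfolding ad.carrier_F by blast
      then show "x \<in> L2_carrier (susp (susp L))" unfolding carrier x by blast
      from p show "x \<in> homogeneous path_deg n"
        unfolding x
      proof (induction rule: scal.span_induct_alt)
        case (step r z y)
        then show ?case by (auto simp: ad.ev_gen ev_degree_word intro!: homogeneous_closed)
      qed (simp add: homogeneous_closed)
    qed
  qed
  show ?thesis
    unfolding M by (rule ad.graded_algebra_iso_tensor_algebra)
      (simp_all add: L2_def component flip: carrier del: ad.carrier_F)
qed

end
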